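(* Let $f\in C^{2}([0,\infty))$ be convex and satisfy $f(0)>0$, $f'\ge 0$ and $\lim_{s\to\infty} f(s)/s=\infty$. Let $u$ be a positive semistable solution of the problem $Lu+f(u)=0$ in $\Omega$, $u=0$ on $\partial\Omega$. Then for every $0\le\beta<1$ we have $$H_{f,\beta}(u):=f(u)\int_{0}^{u}f(t)f''(t)\,e^{2\beta\int_{0}^{t}\sqrt{\frac{f''(s)}{f(s)}}\,ds}\,dt\in L^{1}(\Omega),$$ where membership in $L^1(\Omega)$ means that the $L^1(\Omega)$ norm of $H_{f,\beta}(u)$ is bounded by a constant independent of $u$.
   Context: Setting: $n\ge 2$, $\Omega\subset\mathbb{R}^n$ is a smooth bounded domain, and $Lu:=\partial_i(a^{ij}(x)u_j)$ (summation over repeated indices, $u_j=\partial_j u$) is uniformly elliptic: $(a^{ij}(x))$ is a symmetric $n\times n$ matrix with bounded measurable coefficients, $a^{ij}=a^{ji}\in L^\infty(\Omega)$, and there are positive constants $c_0,C_0$ with $c_0|\xi|^2\le a^{ij}(x)\xi_i\xi_j\le C_0|\xi|^2$ for all $\xi\in\mathbb{R}^n$, $x\in\Omega$. A solution $u$ is semistable if the lowest Dirichlet eigenvalue of the linearized operator at $u$ is nonnegative, that is, $\int_\Omega f'(u)\eta^2\,dx\le\int_\Omega a^{ij}(x)\eta_i\eta_j\,dx$ for all $\eta\in H^1_0(\Omega)$. *)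

theory Defs
  imports "HOL-Analysis.Analysis"
begin

section \<open>Smooth functions and domains\<close>

definition partial_deriv :: "'n::finite \<Rightarrow> (real^'n \<Rightarrow> real) \<Rightarrow> real^'n \<Rightarrow> real" where
  "partial_deriv i \<phi> x = frechet_derivative \<phi> (at x) (axis i 1)"

definition gradient :: "(real^'n::finite \<Rightarrow> real) \<Rightarrow> real^'n \<Rightarrow> real^'n" where
  "gradient \<phi> x = (\<chi> i. partial_deriv i \<phi> x)"

primrec C_k :: "nat \<Rightarrow> (real^'n::finite \<Rightarrow> real) \<Rightarrow> bool" where
  "C_k 0 \<phi> \<longleftrightarrow> continuous_on UNIV \<phi>"
| "C_k (Suc k) \<phi> \<longleftrightarrow> (\<forall>x. \<phi> differentiable (at x)) \<and> (\<forall>i. C_k k (partial_deriv i \<phi>))"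

definition smooth :: "(real^'n::finite \<Rightarrow> real) \<Rightarrow> bool" where
  "smooth \<phi> \<longleftrightarrow> (\<forall>k. C_k k \<phi>)"

text \<open>The space of smooth functions with compact support in \<open>\<Omega>\<close> (extended by zero).\<close>

definition test_functions :: "(real^'n::finite) set \<Rightarrow> (real^'n \<Rightarrow> real) set" where
  "test_functions \<Omega> = {\<phi>. smooth \<phi> \<and> compact (closure {x. \<phi> x \<noteq> 0}) \<and> closure {x. \<phi> x \<noteq> 0} \<subseteq> \<Omega>}"

text \<open>
  Near each boundary point, up to the choice of the coordinate axis \<open>i\<close> and of its orientation
  \<open>\<sigma>\<close>, the domain lies strictly above the graph of a smooth function \<open>\<gamma>\<close> of the remaining
  coordinates; \<open>\<gamma>\<close> is represented as a function on the whole space that does not depend on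
  the \<open>i\<close>-th coordinate.
\<close>

definition smooth_boundary :: "(real^'n::finite) set \<Rightarrow> bool" where
  "smooth_boundary \<Omega> \<longleftrightarrow>
     (\<forall>p \<in> frontier \<Omega>. \<exists>r>0. \<exists>i. \<exists>\<sigma>\<in>{-1, 1}. \<exists>\<gamma>. smooth \<gamma> \<and>
        (\<forall>x t. \<gamma> (x + t *\<^sub>R axis i 1) = \<gamma> x) \<and>
        \<Omega> \<inter> ball p r = {x \<in> ball p r. \<sigma> * x $ i > \<gamma> x})"

definition smooth_bounded_domain :: "(real^'n::finite) set \<Rightarrow> bool" where
  "smooth_bounded_domain \<Omega> \<longleftrightarrow>
     open \<Omega> \<and> connected \<Omega> \<and> \<Omega> \<noteq> {} \<and> bounded \<Omega> \<and> smooth_boundary \<Omega>"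


section \<open>Sobolev spaces\<close>

definition locally_integrable :: "(real^'n::finite) set \<Rightarrow> (real^'n \<Rightarrow> real) \<Rightarrow> bool" where
  "locally_integrable \<Omega> u \<longleftrightarrow> (\<forall>K. compact K \<and> K \<subseteq> \<Omega> \<longrightarrow> integrable (lebesgue_on K) u)"

definition L2 :: "(real^'n::finite) set \<Rightarrow> (real^'n \<Rightarrow> 'b::euclidean_space) set" where
  "L2 \<Omega> = {v. v \<in> borel_measurable (lebesgue_on \<Omega>) \<and>
              integrable (lebesgue_on \<Omega>) (\<lambda>x. (norm (v x))\<^sup>2)}"

definition weak_gradient ::
  "(real^'n::finite) set \<Rightarrow> (real^'n \<Rightarrow> real) \<Rightarrow> (real^'n \<Rightarrow> real^'n) \<Rightarrow> bool" where
  "weak_gradient \<Omega> u Du \<longleftrightarrow>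
     locally_integrable \<Omega> u \<and> (\<forall>i. locally_integrable \<Omega> (\<lambda>x. Du x $ i)) \<and>
     (\<forall>\<phi> \<in> test_functions \<Omega>. \<forall>i.
        (LINT x|lebesgue_on \<Omega>. u x * partial_deriv i \<phi> x) =
        - (LINT x|lebesgue_on \<Omega>. Du x $ i * \<phi> x))"

text \<open>
  An element of a Sobolev space is represented by a pair of a function and its weak gradient.
  The gradient is determined by the function up to null sets.
\<close>

definition H1 :: "(real^'n::finite) set \<Rightarrow> ((real^'n \<Rightarrow> real) \<times> (real^'n \<Rightarrow> real^'n)) set" where
  "H1 \<Omega> = {(u, Du). u \<in> L2 \<Omega> \<and> Du \<in> L2 \<Omega> \<and> weak_gradient \<Omega> u Du}"

text \<open>The closure in \<open>H1 \<Omega>\<close> of the test functions, with respect to the (squared) \<open>H1\<close> norm.\<close>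

definition H10 :: "(real^'n::finite) set \<Rightarrow> ((real^'n \<Rightarrow> real) \<times> (real^'n \<Rightarrow> real^'n)) set" where
  "H10 \<Omega> = {(u, Du) \<in> H1 \<Omega>. \<exists>\<phi>. (\<forall>k::nat. \<phi> k \<in> test_functions \<Omega>) \<and>
     (\<lambda>k. (LINT x|lebesgue_on \<Omega>. (\<phi> k x - u x)\<^sup>2) +
          (LINT x|lebesgue_on \<Omega>. (norm (gradient (\<phi> k) x - Du x))\<^sup>2)) \<longlonglongrightarrow> 0}"


section \<open>The equation\<close>

definition uniformly_elliptic :: "(real^'n::finite) set \<Rightarrow> (real^'n \<Rightarrow> real^'n^'n) \<Rightarrow> bool" where
  "uniformly_elliptic \<Omega> a \<longleftrightarrow>
     (\<forall>i j. (\<lambda>x. a x $ i $ j) \<in> borel_measurable (lebesgue_on \<Omega>) \<and>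
            (\<exists>M. AE x in lebesgue_on \<Omega>. \<bar>a x $ i $ j\<bar> \<le> M)) \<and>
     (\<forall>x\<in>\<Omega>. transpose (a x) = a x) \<and>
     (\<exists>c0>0. \<exists>C0>0. \<forall>x\<in>\<Omega>. \<forall>\<xi>.
        c0 * (norm \<xi>)\<^sup>2 \<le> \<xi> \<bullet> (a x *v \<xi>) \<and> \<xi> \<bullet> (a x *v \<xi>) \<le> C0 * (norm \<xi>)\<^sup>2)"

text \<open>
  As the coefficients are merely bounded and measurable, the equation \<open>\<partial>\<^sub>i(a\<^sup>i\<^sup>j \<partial>\<^sub>j u) + f(u) = 0\<close>
  is understood in the sense of distributions and \<open>u = 0\<close> on the boundary in the sense of \<open>H10\<close>.
\<close>

definition dirichlet_solution ::
  "(real^'n::finite) set \<Rightarrow> (real^'n \<Rightarrow> real^'n^'n) \<Rightarrow> (real \<Rightarrow> real) \<Rightarrow> (real^'n \<Rightarrow> real) \<Rightarrow> bool" where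
  "dirichlet_solution \<Omega> a f u \<longleftrightarrow>
     locally_integrable \<Omega> (\<lambda>x. f (u x)) \<and>
     (\<exists>Du. (u, Du) \<in> H10 \<Omega> \<and>
       (\<forall>\<phi> \<in> test_functions \<Omega>.
          (LINT x|lebesgue_on \<Omega>. gradient \<phi> x \<bullet> (a x *v Du x)) =
          (LINT x|lebesgue_on \<Omega>. f (u x) * \<phi> x)))"

text \<open>
  Here \<open>f'\<close> is the derivative of the nonlinearity. The left-hand integrand is nonnegative when
  \<open>f'\<close> is, so that the inequality includes the finiteness of the left-hand side.
\<close>

definition semistable ::
  "(real^'n::finite) set \<Rightarrow> (real^'n \<Rightarrow> real^'n^'n) \<Rightarrow> (real \<Rightarrow> real) \<Rightarrow> (real^'n \<Rightarrow> real) \<Rightarrow> bool" where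
  "semistable \<Omega> a f' u \<longleftrightarrow>
     (\<forall>(\<eta>, D\<eta>) \<in> H10 \<Omega>.
        integrable (lebesgue_on \<Omega>) (\<lambda>x. f' (u x) * (\<eta> x)\<^sup>2) \<and>
        (LINT x|lebesgue_on \<Omega>. f' (u x) * (\<eta> x)\<^sup>2) \<le>
        (LINT x|lebesgue_on \<Omega>. D\<eta> x \<bullet> (a x *v D\<eta> x)))"

text \<open>\<open>f\<close> is of class \<open>C\<^sup>2\<close> on the closed half-line, with derivatives \<open>f'\<close> and \<open>f''\<close>
  (one-sided at the origin).\<close>

definition C2_half_line :: "(real \<Rightarrow> real) \<Rightarrow> (real \<Rightarrow> real) \<Rightarrow> (real \<Rightarrow> real) \<Rightarrow> bool" where
  "C2_half_line f f' f'' \<longleftrightarrow>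
     (\<forall>t\<ge>0. (f has_real_derivative f' t) (at t within {0..}) \<and>
            (f' has_real_derivative f'' t) (at t within {0..})) \<and>
     continuous_on {0..} f''"

definition H_fun :: "(real \<Rightarrow> real) \<Rightarrow> (real \<Rightarrow> real) \<Rightarrow> real \<Rightarrow> real \<Rightarrow> real" where
  "H_fun f f'' \<beta> y =
     f y * integral {0..y} (\<lambda>t. f t * f'' t *
       exp (2 * \<beta> * integral {0..t} (\<lambda>s. sqrt (f'' s / f s))))"

end

theory Submission
  imports Defs
begin

text \<open>
  Put \<open>E(t) = exp (\<beta> \<integral>\<^sub>0\<^sup>t \<surd>(f''/f))\<close>. The stability inequality is tested with \<open>g(u)\<close>, where
  \<open>g = f E - f(0)\<close>, and the equation with \<open>G(u)\<close>, where \<open>G\<close> is the primitive of \<open>g'\<^sup>2\<close> with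
  \<open>G(0) = 0\<close>. Both produce the integral of \<open>g'(u)\<^sup>2 a\<^sup>i\<^sup>j u\<^sub>i u\<^sub>j\<close>, so that
  \<open>\<integral> f'(u) g(u)\<^sup>2 - f(u) G(u) \<le> 0\<close>. The point of the choice of \<open>E\<close> is the identity
  \<open>g'\<^sup>2 = (f f' E\<^sup>2)' - (1 - \<beta>\<^sup>2) f f'' E\<^sup>2\<close>: the terms \<open>f\<^sup>2 f' E\<^sup>2\<close> cancel and, with
  \<open>I(t) = \<integral>\<^sub>0\<^sup>t f f'' E\<^sup>2\<close>,

    \<open>f' g\<^sup>2 - f G = (1 - \<beta>\<^sup>2) f I - 2 f(0) f f' E + f(0)\<^sup>2 f' + f(0) f'(0) f\<close>.

  Here \<open>f I\<close> is exactly the function whose integral is to be bounded. The only negative term is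
  absorbed by \<open>f' E \<le> \<epsilon> I + C\<^sub>\<epsilon>\<close> (\<open>weighted_slope_le_gain\<close>) and by \<open>I \<rightarrow> \<infinity>\<close>, both of which come from
  the superlinear growth of \<open>f\<close>. Hence \<open>f' g\<^sup>2 - f G \<ge> c f I - C\<close> with constants that depend on \<open>f\<close> and
  \<open>\<beta>\<close> only, and an integration over the bounded domain gives the claim.

  Three points need care, as \<open>u\<close> is only a weak solution.

  \<^item> The function \<open>g\<close> is not Lipschitz, so that \<open>g(u)\<close> need not belong to the Sobolev space. It is
    replaced by the function built in the same way from a nonlinearity \<open>p\<close> that equals \<open>f\<close> on \<open>[0, k]\<close>
    and is affine on \<open>[k + 1, \<infinity>)\<close>. The stability inequality still contains \<open>f\<close> and \<open>f'\<close>, but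
    \<open>p'/p \<le> f'/f\<close> (\<open>trunc_log_slope_le\<close>), which turns the lower bound for \<open>p' g\<^sup>2 - p G\<close> into one for
    \<open>f' g\<^sup>2 - f G\<close>, uniformly in \<open>k\<close> (\<open>truncated_trial_functions\<close>). Fatou's lemma removes \<open>k\<close>.

  \<^item> The chain rule for \<open>g(u)\<close> in the closure of the test functions (\<open>H10_chain_rule\<close>): test functions
    form an algebra, so that polynomials without constant term act on them, and by Weierstrass'
    theorem \<open>g\<close> is \<open>C\<^sup>1\<close>-close to such a polynomial on the range of each approximating test function.

  \<^item> The equation is known for test functions only, and \<open>f(u)\<close> is only locally integrable.
    Convexity gives \<open>f(u) \<le> f(0) + u f'(u)\<close>, and stability bounds \<open>\<integral> f'(u) \<eta>\<^sup>2\<close> by the Dirichlet energy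
    of \<open>\<eta>\<close>. By the Cauchy-Schwarz inequality \<open>\<eta> \<mapsto> \<integral> f(u) \<eta>\<close> is then continuous for the Sobolev
    norm, and the equation passes to the closure (\<open>equation_H10\<close>).
\<close>

section \<open>Calculus on the half-line\<close>

lemma integral_has_real_derivative_half_line:
  fixes h :: "real \<Rightarrow> real"
  assumes "continuous_on {0..} h" "0 \<le> t"
  shows "((\<lambda>t. integral {0..t} h) has_real_derivative h t) (at t within {0..})"
proof -
  have "((\<lambda>t. integral {0..t} h) has_real_derivative h t) (at t within {0..t+1})"
    using assms by (intro integral_has_real_derivative continuous_on_subset[OF assms(1)]) auto
  moreover have "at t within {0..t+1} = at t within {0..}"
    by (rule at_within_nhd[of _ "{..<t+1}"]) auto
  ultimately show ?thesis by simp
qed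

lemma has_real_derivative_half_line_imp_continuous_on:
  fixes h h' :: "real \<Rightarrow> real"
  assumes "\<And>t. 0 \<le> t \<Longrightarrow> (h has_real_derivative h' t) (at t within {0..})"
  shows "continuous_on {0..} h"
  using assms by (meson DERIV_continuous_on atLeast_iff)

lemma nondecreasing_half_line:
  fixes h h' :: "real \<Rightarrow> real"
  assumes "\<And>s. a \<le> s \<Longrightarrow> s \<le> t \<Longrightarrow> (h has_real_derivative h' s) (at s within {0..})"
    and "\<And>s. a \<le> s \<Longrightarrow> s \<le> t \<Longrightarrow> 0 \<le> h' s" and "0 \<le> a" "a \<le> t"
  shows "h a \<le> h t"
proof -
  have "\<exists>x\<in>{a..t}. h t - h a = (*) (h' x) (t - a)"
  proof (rule mvt_very_simple[OF \<open>a \<le> t\<close>])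
    fix x assume "a \<le> x" "x \<le> t"
    then have "(h has_real_derivative h' x) (at x within {a..t})"
      using assms(3) by (intro has_field_derivative_subset[OF assms(1)]) auto
    then show "(h has_derivative (*) (h' x)) (at x within {a..t})"
      by (simp add: has_field_derivative_def)
  qed
  then obtain x where x: "x \<in> {a..t}" "h t - h a = h' x * (t - a)" by auto
  then have "0 \<le> h' x * (t - a)" using assms by auto
  then show ?thesis using x by simp
qed

lemma equal_derivatives_half_line:
  fixes h k d :: "real \<Rightarrow> real"
  assumes "\<And>s. 0 \<le> s \<Longrightarrow> (h has_real_derivative d s) (at s within {0..})"
    and "\<And>s. 0 \<le> s \<Longrightarrow> (k has_real_derivative d s) (at s within {0..})"
    and "h 0 = k 0" "0 \<le> t"
  shows "h t = k t"
proof (rule antisym)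
  have *: "x t \<le> y t" if "\<And>s. 0 \<le> s \<Longrightarrow> (x has_real_derivative d s) (at s within {0..})"
    and "\<And>s. 0 \<le> s \<Longrightarrow> (y has_real_derivative d s) (at s within {0..})" and "x 0 = y 0"
  for x y :: "real \<Rightarrow> real"
  proof -
    have "y 0 - x 0 \<le> y t - x t"
    proof (rule nondecreasing_half_line[of 0 t "\<lambda>s. y s - x s" "\<lambda>s. d s - d s"])
      show "((\<lambda>s. y s - x s) has_real_derivative d s - d s) (at s within {0..})" if "0 \<le> s" for s
        using DERIV_diff that \<open>\<And>s. 0 \<le> s \<Longrightarrow> (x has_real_derivative d s) (at s within {0..})\<close>
          \<open>\<And>s. 0 \<le> s \<Longrightarrow> (y has_real_derivative d s) (at s within {0..})\<close> by blast
    qed (use \<open>0 \<le> t\<close> in auto)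
    then show ?thesis using that by simp
  qed
  show "h t \<le> k t" "k t \<le> h t" using * assms by auto
qed

lemma nonneg_of_second_derivative:
  fixes h h' h'' :: "real \<Rightarrow> real"
  assumes "\<And>s. 0 \<le> s \<Longrightarrow> s \<le> t \<Longrightarrow> (h has_real_derivative h' s) (at s within {0..})"
    and "\<And>s. 0 \<le> s \<Longrightarrow> s \<le> t \<Longrightarrow> (h' has_real_derivative h'' s) (at s within {0..})"
    and "\<And>s. 0 \<le> s \<Longrightarrow> s \<le> t \<Longrightarrow> 0 \<le> h'' s"
    and "0 \<le> h' 0" "0 \<le> h 0" "0 \<le> t"
  shows "0 \<le> h t"
proof -
  have "0 \<le> h' s" if "0 \<le> s" "s \<le> t" for s
    using nondecreasing_half_line[of 0 s h' h''] assms that by force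
  then show ?thesis
    using nondecreasing_half_line[of 0 t h h'] assms by force
qed

text \<open>
  The tangents lie below the graph, so that \<open>f'\<close> is monotone on the open half-line; the endpoint
  follows by continuity of \<open>f''\<close>.
\<close>

lemma convex_second_derivative_nonneg:
  assumes "C2_half_line f f' f''" "convex_on {0..} f" "0 \<le> t"
  shows "0 \<le> f'' t"
proof -
  have d: "(f has_real_derivative f' s) (at s within {0..})"
    "(f' has_real_derivative f'' s) (at s within {0..})" if "0 \<le> s" for s
    using assms(1) that by (auto simp: C2_half_line_def)
  have tangent: "f' s * (y - s) \<le> f y - f s" if "0 < s" "0 \<le> y" for s y
    using that d(1)[of s] by (intro convex_on_imp_above_tangent[OF assms(2)]) auto
  have mono: "mono_on {0<..} f'"
  proof (rule mono_onI)
    fix s r :: real assume sr: "s \<in> {0<..}" "r \<in> {0<..}" "s \<le> r"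
    have "f' s * (r - s) \<le> f' r * (r - s)"
      using tangent[of s r] tangent[of r s] sr by (simp add: algebra_simps)
    then show "f' s \<le> f' r" using sr by (cases "s = r") auto
  qed
  have pos: "0 \<le> f'' s" if "0 < s" for s
  proof (rule mono_on_imp_deriv_nonneg[OF mono])
    show "(f' has_real_derivative f'' s) (at s)"
      using d(2)[of s] that at_within_interior[of s "{0..}"] by simp
  qed (use that in \<open>simp add: interior_open\<close>)
  show ?thesis
  proof (cases "t = 0")
    case True
    have "(f'' \<longlongrightarrow> f'' 0) (at 0 within {0..})"
      using assms(1) by (auto simp: C2_half_line_def continuous_on_def)
    then have "(f'' \<longlongrightarrow> f'' 0) (at_right 0)"
      by (rule tendsto_within_subset) auto
    moreover have "\<forall>\<^sub>F s in at_right 0. 0 \<le> f'' s"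
      using pos by (auto simp: eventually_at_filter)
    ultimately have "0 \<le> f'' 0" by (intro tendsto_lowerbound) auto
    then show ?thesis using True by simp
  qed (use pos assms(3) in auto)
qed

text \<open>
  The chain rule below is stated for functions on the whole line. A \<open>C\<^sup>1\<close> function on the half-line
  is extended by its tangent at the origin.
\<close>

lemma has_real_derivative_linear_extension:
  fixes g g' :: "real \<Rightarrow> real"
  assumes g: "\<And>t. 0 \<le> t \<Longrightarrow> (g has_real_derivative g' t) (at t within {0..})"
  shows "((\<lambda>t. if 0 \<le> t then g t else g 0 + g' 0 * t) has_real_derivative g' (max 0 t)) (at t)"
    (is "(?h has_real_derivative _) _")
proof -
  have left: "(?h has_real_derivative g' 0) (at s within {..0})" if "s \<le> 0" for s
  proof (rule has_field_derivative_transform_within[of "\<lambda>t. g 0 + g' 0 * t" _ _ _ 1])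
    show "((\<lambda>t. g 0 + g' 0 * t) has_real_derivative g' 0) (at s within {..0})"
      by (auto intro!: derivative_eq_intros)
  qed (use that in auto)
  have right: "(?h has_real_derivative g' s) (at s within {0..})" if "0 \<le> s" for s
    by (rule has_field_derivative_transform_within[OF g[OF that], of 1]) (use that in auto)
  consider "t < 0" | "t = 0" | "0 < t" by linarith
  then show ?thesis
  proof cases
    case 1
    then show ?thesis using left[of t] at_within_interior[of t "{..0}"] by simp
  next
    case 2
    have "(?h has_real_derivative g' 0) (at 0 within ({..0} \<union> {0..}))"
      using left[of 0] right[of 0] by (simp add: has_field_derivative_iff Lim_within_Un)
    moreover have "{..0} \<union> {0..} = (UNIV :: real set)" by auto
    ultimately show ?thesis using 2 by simp
  next
    case 3
    then show ?thesis using right[of t] at_within_interior[of t "{0..}"] by simp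
  qed
qed

lemma continuous_on_compose_max_0:
  fixes g :: "real \<Rightarrow> real"
  assumes "continuous_on {0..} g" shows "continuous_on UNIV (\<lambda>t. g (max 0 t))"
  by (rule continuous_on_compose2[OF assms]) (auto intro: continuous_intros)

section \<open>The pointwise inequality\<close>

text \<open>
  Superlinear growth is kept out of this locale, as it fails for the truncated nonlinearities, to
  which everything here is applied as well.
\<close>

locale increasing_convex =
  fixes f f' f'' :: "real \<Rightarrow> real" and \<beta> :: real
  assumes C2: "C2_half_line f f' f''"
    and f''_nonneg: "0 \<le> t \<Longrightarrow> 0 \<le> f'' t"
    and f'_0: "0 \<le> f' 0" and f_0: "0 < f 0"
    and \<beta>_nonneg: "0 \<le> \<beta>" and \<beta>_less: "\<beta> < 1"
begin

lemma f_deriv: "0 \<le> t \<Longrightarrow> (f has_real_derivative f' t) (at t within {0..})"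
  and f'_deriv: "0 \<le> t \<Longrightarrow> (f' has_real_derivative f'' t) (at t within {0..})"
  and f''_cont: "continuous_on {0..} f''"
  using C2 by (auto simp: C2_half_line_def)

lemma f_cont: "continuous_on {0..} f" and f'_cont: "continuous_on {0..} f'"
  using f_deriv f'_deriv by (auto intro: has_real_derivative_half_line_imp_continuous_on)

lemma f'_mono: "0 \<le> s \<Longrightarrow> s \<le> t \<Longrightarrow> f' s \<le> f' t"
  using nondecreasing_half_line[of s t f' f''] f'_deriv f''_nonneg by force

lemma f'_nonneg: "0 \<le> t \<Longrightarrow> 0 \<le> f' t"
  using f'_mono[of 0 t] f'_0 by simp

lemma f_mono: "0 \<le> s \<Longrightarrow> s \<le> t \<Longrightarrow> f s \<le> f t"
  using nondecreasing_half_line[of s t f f'] f_deriv f'_nonneg by force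

lemma f_pos: "0 \<le> t \<Longrightarrow> 0 < f t"
  using f_mono[of 0 t] f_0 by simp

text \<open>
  Convexity, read at the right endpoint: it makes \<open>f(u)\<close> controllable by \<open>u f'(u)\<close>, hence by stability.
\<close>

lemma f_le_tangent_at_endpoint:
  assumes "0 \<le> t" shows "f t \<le> f 0 + t * f' t"
proof -
  have "0 * f' 0 - f 0 \<le> t * f' t - f t"
  proof (rule nondecreasing_half_line[of 0 t "\<lambda>t. t * f' t - f t" "\<lambda>t. t * f'' t"])
    fix s :: real assume "0 \<le> s"
    then show "((\<lambda>t. t * f' t - f t) has_real_derivative s * f'' s) (at s within {0..})"
      by (auto intro!: derivative_eq_intros f_deriv f'_deriv)
  qed (use f''_nonneg assms in auto)
  then show ?thesis by simp
qed

text \<open>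
  With \<open>E = weight\<close>, the functions \<open>g\<close>, \<open>g'\<close>, \<open>G\<close> and \<open>I\<close> of the introduction are \<open>trial\<close>, \<open>trial'\<close>,
  \<open>trial_energy\<close> and \<open>gain\<close>. In \<open>trial'\<close> the product \<open>rate t * f t\<close> stands for \<open>\<surd>(f f'')\<close>.
\<close>

definition rate :: "real \<Rightarrow> real" where
  "rate s = sqrt (f'' s / f s)"

definition weight :: "real \<Rightarrow> real" where
  "weight t = exp (\<beta> * integral {0..t} rate)"

definition trial :: "real \<Rightarrow> real" where
  "trial t = f t * weight t - f 0"

definition trial' :: "real \<Rightarrow> real" where
  "trial' t = weight t * (f' t + \<beta> * (rate t * f t))"

definition trial_energy :: "real \<Rightarrow> real" where
  "trial_energy t = integral {0..t} (\<lambda>s. (trial' s)\<^sup>2)"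

definition gain :: "real \<Rightarrow> real" where
  "gain t = integral {0..t} (\<lambda>s. f s * f'' s * (weight s)\<^sup>2)"

lemma rate_nonneg: "0 \<le> s \<Longrightarrow> 0 \<le> rate s"
  using f''_nonneg f_pos by (simp add: rate_def less_imp_le)

lemma rate_squared: "0 \<le> s \<Longrightarrow> (rate s)\<^sup>2 = f'' s / f s"
  using f''_nonneg f_pos by (simp add: rate_def less_imp_le)

lemma rate_cont: "continuous_on {0..} rate"
  unfolding rate_def using f_pos
  by (intro continuous_intros f''_cont f_cont) (metis atLeast_iff less_irrefl)

lemma weight_deriv:
  "0 \<le> t \<Longrightarrow> (weight has_real_derivative weight t * (\<beta> * rate t)) (at t within {0..})"
  unfolding weight_def
  by (auto intro!: derivative_eq_intros integral_has_real_derivative_half_line rate_cont)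

lemma weight_cont: "continuous_on {0..} weight"
  using weight_deriv by (rule has_real_derivative_half_line_imp_continuous_on)

lemma weight_pos: "0 < weight t" by (simp add: weight_def)

lemma weight_0: "weight 0 = 1" by (simp add: weight_def)

lemma weight_mono: "0 \<le> s \<Longrightarrow> s \<le> t \<Longrightarrow> weight s \<le> weight t"
  using nondecreasing_half_line[of s t weight "\<lambda>t. weight t * (\<beta> * rate t)"]
    weight_deriv rate_nonneg \<beta>_nonneg weight_pos by (simp add: less_imp_le)

lemma weight_ge_1: "0 \<le> t \<Longrightarrow> 1 \<le> weight t"
  using weight_mono[of 0 t] weight_0 by simp

lemma trial'_cont: "continuous_on {0..} trial'"
  unfolding trial'_def by (intro continuous_intros weight_cont f'_cont rate_cont f_cont)

lemma trial_deriv: "0 \<le> t \<Longrightarrow> (trial has_real_derivative trial' t) (at t within {0..})"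
  unfolding trial_def trial'_def
  by (auto intro!: derivative_eq_intros f_deriv weight_deriv simp: algebra_simps)

lemma trial_0: "trial 0 = 0" by (simp add: trial_def weight_0)

lemma trial_energy_deriv:
  "0 \<le> t \<Longrightarrow> (trial_energy has_real_derivative (trial' t)\<^sup>2) (at t within {0..})"
  unfolding trial_energy_def
  by (intro integral_has_real_derivative_half_line continuous_intros trial'_cont)

lemma trial_energy_0: "trial_energy 0 = 0" by (simp add: trial_energy_def)

lemma gain_integrand_cont: "continuous_on {0..} (\<lambda>s. f s * f'' s * (weight s)\<^sup>2)"
  by (intro continuous_intros f_cont f''_cont weight_cont)

lemma gain_deriv:
  "0 \<le> t \<Longrightarrow> (gain has_real_derivative f t * f'' t * (weight t)\<^sup>2) (at t within {0..})"
  unfolding gain_def by (intro integral_has_real_derivative_half_line gain_integrand_cont)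

lemma gain_0: "gain 0 = 0" by (simp add: gain_def)

lemma gain_mono: "0 \<le> s \<Longrightarrow> s \<le> t \<Longrightarrow> gain s \<le> gain t"
  using nondecreasing_half_line[of s t gain "\<lambda>t. f t * f'' t * (weight t)\<^sup>2"]
    gain_deriv f''_nonneg f_pos by (simp add: less_imp_le)

lemma gain_nonneg: "0 \<le> t \<Longrightarrow> 0 \<le> gain t"
  using gain_mono[of 0 t] gain_0 by simp

lemma H_fun_eq_gain: "0 \<le> t \<Longrightarrow> H_fun f f'' \<beta> t = f t * gain t"
  unfolding H_fun_def gain_def weight_def rate_def
  by (simp add: exp_double[symmetric] mult.assoc)

text \<open>
  Both sides vanish at \<open>0\<close>, and
  \<open>(f f' E\<^sup>2)' = E\<^sup>2 (f'\<^sup>2 + f f'' + 2 \<beta> f' \<surd>(f f''))\<close> differs from \<open>g'\<^sup>2 = E\<^sup>2 (f' + \<beta> \<surd>(f f''))\<^sup>2\<close>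
  by \<open>(1 - \<beta>\<^sup>2) f f'' E\<^sup>2\<close>.
\<close>

lemma trial_energy_eq:
  assumes "0 \<le> t"
  shows "trial_energy t = f t * f' t * (weight t)\<^sup>2 - f 0 * f' 0 - (1 - \<beta>\<^sup>2) * gain t"
proof (rule equal_derivatives_half_line[of trial_energy "\<lambda>t. (trial' t)\<^sup>2" _ t])
  fix s :: real assume s: "0 \<le> s"
  then have f'': "f'' s = (rate s)\<^sup>2 * f s" using f_pos[OF s] by (simp add: rate_squared)
  have "((\<lambda>t. f t * f' t * (weight t)\<^sup>2 - f 0 * f' 0 - (1 - \<beta>\<^sup>2) * gain t) has_real_derivative
      (f' s * f' s + f s * f'' s) * (weight s)\<^sup>2
      + f s * f' s * (2 * weight s * (weight s * (\<beta> * rate s)))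
      - (1 - \<beta>\<^sup>2) * (f s * f'' s * (weight s)\<^sup>2)) (at s within {0..})"
    using s by (auto intro!: derivative_eq_intros f_deriv f'_deriv weight_deriv gain_deriv
        simp: algebra_simps)
  then show "((\<lambda>t. f t * f' t * (weight t)\<^sup>2 - f 0 * f' 0 - (1 - \<beta>\<^sup>2) * gain t) has_real_derivative
      (trial' s)\<^sup>2) (at s within {0..})"
    unfolding trial'_def f'' by (rule back_subst) (auto simp: algebra_simps power2_eq_square)
qed (use assms trial_energy_deriv in \<open>auto simp: trial_energy_0 gain_0 weight_0\<close>)

lemma stability_balance:
  assumes "0 \<le> t"
  shows "f' t * (trial t)\<^sup>2 - f t * trial_energy t =
    (1 - \<beta>\<^sup>2) * (f t * gain t) - 2 * f 0 * (f t * (f' t * weight t))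
    + (f 0)\<^sup>2 * f' t + f t * f' 0 * f 0"
  unfolding trial_energy_eq[OF assms] trial_def
  by (simp add: algebra_simps power2_eq_square)

text \<open>
  The term to be absorbed. With \<open>A = \<beta>\<^sup>2/(2\<epsilon>)\<close> the function \<open>D = \<epsilon> I - f' E - A f'/f\<close> increases beyond any
  \<open>T\<close> with \<open>f(T)\<close> large: in \<open>(f' E)' = f'' E + \<beta> f' \<surd>(f''/f) E\<close> the mixed term is at most
  \<open>(\<epsilon>/2) f f'' E\<^sup>2 + A (f'/f)\<^sup>2\<close>, and the last summand is compensated by \<open>(f'/f)' = f''/f - (f'/f)\<^sup>2\<close>.
  The constant involves \<open>f\<close> on \<open>[0, T]\<close> only, so that it is the same for all truncations of \<open>f\<close> beyond \<open>T\<close>.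
\<close>

lemma weighted_slope_le_gain:
  assumes \<epsilon>: "0 < \<epsilon>" and T: "0 \<le> T" and large: "1 \<le> f T" "2 * (1 + \<beta>\<^sup>2 / (2 * \<epsilon>)) / \<epsilon> \<le> f T"
    and t: "0 \<le> t"
  shows "f' t * weight t \<le> \<epsilon> * gain t + (f' T * weight T + \<beta>\<^sup>2 / (2 * \<epsilon>) * (f' T / f T))"
proof -
  define A where "A = \<beta>\<^sup>2 / (2 * \<epsilon>)"
  have A: "0 \<le> A" using \<epsilon> by (simp add: A_def)
  have C: "0 \<le> A * (f' T / f T)" using A T f'_nonneg f_pos by (simp add: less_imp_le)
  show ?thesis
  proof (cases "t \<le> T")
    case True
    have "f' t * weight t \<le> f' T * weight T"
      using t True by (intro mult_mono f'_mono weight_mono f'_nonneg) (auto simp: weight_pos less_imp_le)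
    moreover have "0 \<le> \<epsilon> * gain t" using \<epsilon> gain_nonneg[OF t] by simp
    ultimately show ?thesis using C by (simp add: A_def)
  next
    case False
    define D where "D s = \<epsilon> * gain s - f' s * weight s - A * (f' s / f s)" for s
    define D' where "D' s = \<epsilon> * (f s * f'' s * (weight s)\<^sup>2)
       - (f'' s * weight s + f' s * (weight s * (\<beta> * rate s)))
       - A * ((f'' s * f s - f' s * f' s) / (f s * f s))" for s
    have "D T \<le> D t"
    proof (rule nondecreasing_half_line[of T t D D'])
      fix s assume s: "T \<le> s" "s \<le> t"
      then have s0: "0 \<le> s" using T by simp
      note fs = f_pos[OF s0]
      show "(D has_real_derivative D' s) (at s within {0..})"
        unfolding D_def D'_def using s0 fs
        by (auto intro!: derivative_eq_intros f_deriv f'_deriv weight_deriv gain_deriv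
            simp: right_diff_distrib)
      have W: "1 \<le> weight s" using weight_ge_1 s0 .
      define r where "r = rate s"
      have f''s: "f'' s = r\<^sup>2 * f s" using rate_squared[OF s0] fs by (simp add: r_def)
      have "f T \<le> f s" using T s f_mono by simp
      then have "2 * (1 + A) / \<epsilon> \<le> f s" "1 \<le> f s" using large by (auto simp: A_def)
      then have l: "1 + A \<le> \<epsilon> / 2 * f s" using \<epsilon> by (simp add: field_simps)
      have "r\<^sup>2 * (f s * weight s + A) \<le> r\<^sup>2 * (f s * ((1 + A) * (weight s)\<^sup>2))"
      proof (rule mult_left_mono)
        have "weight s * 1 \<le> weight s * weight s" using W by (intro mult_left_mono) auto
        then have "weight s \<le> (weight s)\<^sup>2" by (simp add: power2_eq_square)
        then have "f s * weight s \<le> f s * (weight s)\<^sup>2" using fs by simp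
        moreover have "1 * (A * 1) \<le> f s * (A * (weight s)\<^sup>2)"
          using W \<open>1 \<le> f s\<close> A by (intro mult_mono) auto
        ultimately show "f s * weight s + A \<le> f s * ((1 + A) * (weight s)\<^sup>2)"
          by (simp add: algebra_simps)
      qed auto
      also have "\<dots> \<le> r\<^sup>2 * (f s * ((\<epsilon> / 2 * f s) * (weight s)\<^sup>2))"
        using l fs by (intro mult_left_mono mult_right_mono) auto
      finally have 1: "f'' s * weight s + A * r\<^sup>2 \<le> \<epsilon> / 2 * (f s * f'' s * (weight s)\<^sup>2)"
        unfolding f''s by (simp add: algebra_simps power2_eq_square)
      define z where "z = f' s / f s"
      have "0 \<le> \<epsilon> / 2 * (r * f s * weight s - \<beta> / \<epsilon> * z)\<^sup>2" using \<epsilon> by simp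
      also have "\<dots> = \<epsilon> / 2 * (r * f s * weight s)\<^sup>2 - \<beta> * (z * f s) * (r * weight s) + A * z\<^sup>2"
        using \<epsilon> by (simp add: A_def power2_eq_square field_simps)
      also have "z * f s = f' s" using fs by (simp add: z_def)
      also have "(r * f s * weight s)\<^sup>2 = f s * f'' s * (weight s)\<^sup>2"
        unfolding f''s by (simp add: power2_eq_square)
      finally have 2: "\<beta> * f' s * (r * weight s) \<le> \<epsilon> / 2 * (f s * f'' s * (weight s)\<^sup>2) + A * z\<^sup>2"
        by simp
      have 3: "(f'' s * f s - f' s * f' s) / (f s * f s) = r\<^sup>2 - z\<^sup>2"
        unfolding f''s z_def using fs by (simp add: field_simps power2_eq_square)
      show "0 \<le> D' s"
        using 1 2 unfolding D'_def r_def[symmetric] 3 by (simp add: algebra_simps)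
    qed (use T False in auto)
    moreover have "0 \<le> \<epsilon> * gain T" using \<epsilon> gain_nonneg[OF T] by simp
    moreover have "0 \<le> A * (f' t / f t)" using A t f'_nonneg f_pos by (simp add: less_imp_le)
    ultimately show ?thesis unfolding D_def A_def by simp
  qed
qed

text \<open>
  The choice of \<open>\<epsilon>\<close> makes the absorbed part \<open>2 f(0) \<epsilon> f I\<close> one half of \<open>(1 - \<beta>\<^sup>2) f I\<close>.
\<close>

lemma stability_lower_bound:
  assumes "0 \<le> T" and "1 \<le> f T"
    and "\<epsilon> = (1 - \<beta>\<^sup>2) / (4 * f 0)" and "2 * (1 + \<beta>\<^sup>2 / (2 * \<epsilon>)) / \<epsilon> \<le> f T"
    and "C = f' T * weight T + \<beta>\<^sup>2 / (2 * \<epsilon>) * (f' T / f T)" and "0 \<le> t"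
  shows "f t * ((1 - \<beta>\<^sup>2) / 2 * gain t - 2 * f 0 * C) \<le> f' t * (trial t)\<^sup>2 - f t * trial_energy t"
proof -
  have "\<beta>\<^sup>2 < 1" using \<beta>_nonneg \<beta>_less by (simp add: power_less_one_iff abs_square_less_1)
  then have \<epsilon>: "0 < \<epsilon>" using assms f_0 by simp
  have "f' t * weight t \<le> \<epsilon> * gain t + C"
    using weighted_slope_le_gain[OF \<epsilon>, of T t] assms by simp
  then have "2 * f 0 * (f t * (f' t * weight t)) \<le> 2 * f 0 * (f t * (\<epsilon> * gain t + C))"
    using f_0 f_pos[OF \<open>0 \<le> t\<close>] by (intro mult_left_mono) auto
  also have "\<dots> = (2 * f 0 * \<epsilon>) * (f t * gain t) + f t * (2 * f 0 * C)"
    by (simp add: algebra_simps)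
  also have "2 * f 0 * \<epsilon> = (1 - \<beta>\<^sup>2) / 2"
    using f_0 assms(3) by (simp add: field_simps)
  finally have "2 * f 0 * (f t * (f' t * weight t)) \<le> (1 - \<beta>\<^sup>2) / 2 * (f t * gain t) + f t * (2 * f 0 * C)" .
  moreover have "0 \<le> (f 0)\<^sup>2 * f' t" "0 \<le> f t * f' 0 * f 0"
    using f'_nonneg f_pos \<open>0 \<le> t\<close> f_0 f'_0 by (auto simp: less_imp_le)
  ultimately show ?thesis
    unfolding stability_balance[OF \<open>0 \<le> t\<close>] by (simp add: field_simps)
qed

section \<open>Truncation of the nonlinearity\<close>

text \<open>
  The second derivative of \<open>f\<close> is cut off continuously between \<open>k\<close> and \<open>k + 1\<close>, so that the truncated
  nonlinearity is again of class \<open>C\<^sup>2\<close> and convex, and affine from \<open>k + 1\<close> on.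
\<close>

definition cutoff :: "real \<Rightarrow> real \<Rightarrow> real" where
  "cutoff k t = max 0 (min 1 (k + 1 - t))"

definition trunc'' :: "real \<Rightarrow> real \<Rightarrow> real" where
  "trunc'' k t = cutoff k t * f'' t"

definition trunc' :: "real \<Rightarrow> real \<Rightarrow> real" where
  "trunc' k t = f' 0 + integral {0..t} (trunc'' k)"

definition trunc :: "real \<Rightarrow> real \<Rightarrow> real" where
  "trunc k t = f 0 + integral {0..t} (trunc' k)"

lemma trunc''_cont: "continuous_on {0..} (trunc'' k)"
  unfolding trunc''_def cutoff_def by (intro continuous_intros f''_cont)

lemma trunc'_deriv:
  "0 \<le> t \<Longrightarrow> (trunc' k has_real_derivative trunc'' k t) (at t within {0..})"
  unfolding trunc'_def
  by (auto intro!: derivative_eq_intros integral_has_real_derivative_half_line trunc''_cont)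

lemma trunc_deriv:
  "0 \<le> t \<Longrightarrow> (trunc k has_real_derivative trunc' k t) (at t within {0..})"
  unfolding trunc_def
  by (auto intro!: derivative_eq_intros integral_has_real_derivative_half_line
      has_real_derivative_half_line_imp_continuous_on[OF trunc'_deriv])

lemma trunc'_0: "trunc' k 0 = f' 0" and trunc_0: "trunc k 0 = f 0"
  by (auto simp: trunc'_def trunc_def)

lemma trunc_increasing_convex: "increasing_convex (trunc k) (trunc' k) (trunc'' k) \<beta>"
proof
  show "C2_half_line (trunc k) (trunc' k) (trunc'' k)"
    unfolding C2_half_line_def using trunc_deriv trunc'_deriv trunc''_cont by auto
  show "0 \<le> trunc'' k t" if "0 \<le> t" for t
    using f''_nonneg[OF that] by (simp add: trunc''_def cutoff_def)
qed (auto simp: trunc'_0 trunc_0 f'_0 f_0 \<beta>_nonneg \<beta>_less)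

lemma trunc''_eq: "t \<le> k \<Longrightarrow> trunc'' k t = f'' t"
  by (simp add: trunc''_def cutoff_def)

lemma trunc'_eq:
  assumes "0 \<le> t" "t \<le> k" shows "trunc' k t = f' t"
proof -
  have "integral {0..t} (trunc'' k) = integral {0..t} f''"
    using assms by (intro integral_cong) (auto simp: trunc''_eq)
  moreover have "f' 0 + integral {0..t} f'' = f' t"
    by (rule equal_derivatives_half_line[OF _ f'_deriv])
      (auto intro!: derivative_eq_intros integral_has_real_derivative_half_line f''_cont assms)
  ultimately show ?thesis by (simp add: trunc'_def)
qed

lemma trunc_eq:
  assumes "0 \<le> t" "t \<le> k" shows "trunc k t = f t"
proof -
  have "integral {0..t} (trunc' k) = integral {0..t} f'"
    using assms by (intro integral_cong) (auto simp: trunc'_eq)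
  moreover have "f 0 + integral {0..t} f' = f t"
    by (rule equal_derivatives_half_line[OF _ f_deriv])
      (auto intro!: derivative_eq_intros integral_has_real_derivative_half_line f'_cont assms)
  ultimately show ?thesis by (simp add: trunc_def)
qed

text \<open>
  As \<open>cutoff k\<close> decreases, its value \<open>c\<close> at \<open>t\<close> satisfies \<open>c f'' \<le> (trunc k)''\<close> on \<open>[0, t]\<close>; integrating
  twice from \<open>0\<close>, where both functions and their first derivatives agree, yields the claim since \<open>c \<le> 1\<close>.
\<close>

lemma cutoff_mult_le_trunc:
  assumes "0 \<le> t" shows "cutoff k t * f t \<le> trunc k t"
proof -
  define c where "c = cutoff k t"
  have c: "0 \<le> 1 - c" by (simp add: c_def cutoff_def)
  have "0 \<le> trunc k t - c * f t"
  proof (rule nonneg_of_second_derivative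
      [of t _ "\<lambda>s. trunc' k s - c * f' s" "\<lambda>s. trunc'' k s - c * f'' s"])
    fix s :: real assume s: "0 \<le> s" "s \<le> t"
    have "c * f'' s \<le> cutoff k s * f'' s"
      using f''_nonneg[OF s(1)] s(2) unfolding c_def
      by (intro mult_right_mono) (auto simp: cutoff_def)
    then show "0 \<le> trunc'' k s - c * f'' s" by (simp add: trunc''_def)
  next
    show "0 \<le> trunc' k 0 - c * f' 0" "0 \<le> trunc k 0 - c * f 0"
      using mult_nonneg_nonneg[OF c f'_0] mult_nonneg_nonneg[OF c less_imp_le[OF f_0]]
      by (simp_all add: trunc_0 trunc'_0 algebra_simps)
  qed (use assms in \<open>auto intro!: DERIV_diff DERIV_cmult f_deriv f'_deriv trunc_deriv trunc'_deriv\<close>)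
  then show ?thesis by (simp add: c_def)
qed

text \<open>
  Truncation decreases the logarithmic derivative: with \<open>p = trunc k\<close> the derivative of \<open>f' p - f p'\<close> is
  \<open>f'' (p - cutoff k * f)\<close>. This lets the truncated function be used in the stability inequality, which
  involves \<open>f\<close> itself: \<open>p (f' g\<^sup>2 - f G) \<ge> f (p' g\<^sup>2 - p G)\<close>.
\<close>

lemma trunc_log_slope_le:
  assumes "0 \<le> t" shows "f t * trunc' k t \<le> f' t * trunc k t"
proof -
  have "f' 0 * trunc k 0 - f 0 * trunc' k 0 \<le> f' t * trunc k t - f t * trunc' k t"
  proof (rule nondecreasing_half_line[of 0 t _ "\<lambda>s. f'' s * (trunc k s - cutoff k s * f s)"])
    fix s :: real assume s: "0 \<le> s"
    show "((\<lambda>s. f' s * trunc k s - f s * trunc' k s) has_real_derivative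
        f'' s * (trunc k s - cutoff k s * f s)) (at s within {0..})"
      using s by (auto intro!: derivative_eq_intros f_deriv f'_deriv trunc_deriv trunc'_deriv
          simp: trunc''_def algebra_simps)
    show "0 \<le> f'' s * (trunc k s - cutoff k s * f s)"
      using cutoff_mult_le_trunc[OF s, of k] f''_nonneg[OF s] by simp
  qed (use assms in auto)
  then show ?thesis by (simp add: trunc_0 trunc'_0 mult.commute)
qed

end

locale superlinear = increasing_convex +
  assumes superlinear: "filterlim (\<lambda>s. f s / s) at_top at_top"
begin

lemma f'_at_top: "filterlim f' at_top at_top"
proof (rule filterlim_at_top_mono)
  show "filterlim (\<lambda>s. - f 0 + f s / s) at_top at_top"
    by (intro filterlim_tendsto_add_at_top[OF tendsto_const superlinear])
  show "\<forall>\<^sub>F s in at_top. - f 0 + f s / s \<le> f' s"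
    using eventually_ge_at_top[of 1]
  proof eventually_elim
    case (elim s)
    have "f s \<le> f 0 * s + s * f' s"
      using f_le_tangent_at_endpoint[of s] mult_left_mono[of 1 s "f 0"] elim f_0 by linarith
    then show ?case using elim by (simp add: field_simps)
  qed
qed

lemma f_at_top: "filterlim f at_top at_top"
proof (rule filterlim_at_top_mono[OF superlinear])
  show "\<forall>\<^sub>F s in at_top. f s / s \<le> f s"
    using eventually_ge_at_top[of 1]
  proof eventually_elim
    case (elim s)
    then show ?case using mult_left_mono[of 1 s "f s"] f_pos[of s] by (simp add: field_simps)
  qed
qed

text \<open>
  Since \<open>f \<ge> f(0)\<close> and \<open>weight \<ge> 1\<close>, the gain is at least \<open>f(0) (f' - f'(0))\<close>.
\<close>

lemma gain_at_top: "filterlim gain at_top at_top"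
proof (rule filterlim_at_top_mono)
  show "filterlim (\<lambda>s. - f 0 * f' 0 + f 0 * f' s) at_top at_top"
    using f_0 by (intro filterlim_tendsto_add_at_top[OF tendsto_const]
      filterlim_tendsto_pos_mult_at_top[OF tendsto_const _ f'_at_top])
  show "\<forall>\<^sub>F s in at_top. - f 0 * f' 0 + f 0 * f' s \<le> gain s"
    using eventually_ge_at_top[of 0]
  proof eventually_elim
    case (elim t)
    have "gain 0 - f 0 * f' 0 \<le> gain t - f 0 * f' t"
    proof (rule nondecreasing_half_line
        [of 0 t _ "\<lambda>s. f s * f'' s * (weight s)\<^sup>2 - f 0 * f'' s"])
      fix s :: real assume s: "0 \<le> s"
      have "f 0 * f'' s * 1 \<le> f s * f'' s * (weight s)\<^sup>2"
        using s weight_ge_1[OF s] f_pos[OF s] f''_nonneg[OF s] f_mono[of 0 s] f_0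
        by (intro mult_mono mult_nonneg_nonneg) auto
      then show "0 \<le> f s * f'' s * (weight s)\<^sup>2 - f 0 * f'' s" by simp
    qed (use elim in \<open>auto intro!: DERIV_diff DERIV_cmult gain_deriv f'_deriv\<close>)
    then show ?case by (simp add: gain_0)
  qed
qed

text \<open>
  Up to a level \<open>S\<close> that depends on \<open>f\<close> and \<open>\<beta>\<close> only, truncations beyond \<open>S\<close> agree with \<open>f\<close>, and the
  negative part of \<open>f' g\<^sup>2 - f G\<close> is bounded by \<open>f(S)\<close> times a constant. Beyond \<open>S\<close> the gain is so large that
  the lower bound for \<open>p' g\<^sup>2 - p G\<close> is nonnegative, and only then may it be multiplied by the possibly
  unbounded factor \<open>f/p\<close>.
\<close>

lemma truncated_trial_functions:
  obtains c C :: real and K :: nat and g g' G :: "nat \<Rightarrow> real \<Rightarrow> real"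
  where "0 < c"
    and "\<And>k t. 0 \<le> t \<Longrightarrow> (g k has_real_derivative g' k t) (at t within {0..})"
    and "\<And>k t. 0 \<le> t \<Longrightarrow> (G k has_real_derivative (g' k t)\<^sup>2) (at t within {0..})"
    and "\<And>k. continuous_on {0..} (g' k)" and "\<And>k. bounded (g' k ` {0..})"
    and "\<And>k. g k 0 = 0" and "\<And>k. G k 0 = 0"
    and "\<And>k t. K \<le> k \<Longrightarrow> 0 \<le> t \<Longrightarrow> - C \<le> f' t * (g k t)\<^sup>2 - f t * G k t"
    and "\<And>k t. K \<le> k \<Longrightarrow> 0 \<le> t \<Longrightarrow> t \<le> real k \<Longrightarrow>
      c * H_fun f f'' \<beta> t - C \<le> f' t * (g k t)\<^sup>2 - f t * G k t"
proof -
  define \<epsilon> where "\<epsilon> = (1 - \<beta>\<^sup>2) / (4 * f 0)"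
  define c where "c = (1 - \<beta>\<^sup>2) / 4"
  have "\<beta>\<^sup>2 < 1" using \<beta>_nonneg \<beta>_less by (simp add: power_less_one_iff abs_square_less_1)
  then have c: "0 < c" by (simp add: c_def)
  \<comment> \<open>\<open>T\<close> is a threshold for \<open>weighted_slope_le_gain\<close>; \<open>D\<close> is the resulting constant.\<close>
  have "\<forall>\<^sub>F T in at_top. 0 \<le> T \<and> 1 \<le> f T \<and> 2 * (1 + \<beta>\<^sup>2 / (2 * \<epsilon>)) / \<epsilon> \<le> f T"
    using f_at_top by (intro eventually_conj eventually_ge_at_top) (auto simp: filterlim_at_top)
  then obtain T where T: "0 \<le> T" "1 \<le> f T" "2 * (1 + \<beta>\<^sup>2 / (2 * \<epsilon>)) / \<epsilon> \<le> f T"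
    by (auto simp: eventually_at_top_linorder)
  define D where "D = f' T * weight T + \<beta>\<^sup>2 / (2 * \<epsilon>) * (f' T / f T)"
  define B where "B = 2 * f 0 * D"
  \<comment> \<open>Beyond \<open>S\<close> half of \<open>2 c I\<close> outweighs the constant \<open>B\<close>.\<close>
  have "\<forall>\<^sub>F S in at_top. T \<le> S \<and> B / c \<le> gain S"
    using gain_at_top by (intro eventually_conj eventually_ge_at_top) (auto simp: filterlim_at_top)
  then obtain S where S: "T \<le> S" "B / c \<le> gain S"
    by (auto simp: eventually_at_top_linorder)
  then have BS: "B \<le> c * gain S" using c by (simp add: field_simps)
  have "0 \<le> S" using S T by simp
  define C where "C = \<bar>f S * B\<bar>"
  define K where "K = nat \<lceil>S\<rceil>"
  interpret P: increasing_convex "trunc k" "trunc' k" "trunc'' k" \<beta> for k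
    by (rule trunc_increasing_convex)
  have rate_eq: "P.rate k s = rate s" if "0 \<le> s" "s \<le> k" for s k
    using that by (simp add: P.rate_def rate_def trunc_eq trunc''_eq)
  have weight_eq: "P.weight k t = weight t" if "0 \<le> t" "t \<le> k" for t k
  proof -
    have "integral {0..t} (P.rate k) = integral {0..t} rate"
      using that by (intro integral_cong) (auto simp: rate_eq)
    then show ?thesis by (simp add: P.weight_def weight_def)
  qed
  have gain_eq: "P.gain k t = gain t" if "0 \<le> t" "t \<le> k" for t k
    unfolding P.gain_def gain_def
    using that by (intro integral_cong) (auto simp: weight_eq trunc_eq trunc''_eq)
  have lower: "trunc k t * (2 * c * P.gain k t - B)
      \<le> trunc' k t * (P.trial k t)\<^sup>2 - trunc k t * P.trial_energy k t" if "S \<le> k" "0 \<le> t" for k t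
  proof -
    have "T \<le> k" using S that by simp
    then have "(1 - \<beta>\<^sup>2) / 2 * P.gain k t - 2 * f 0 * D = 2 * c * P.gain k t - B"
      and eqs: "trunc k T = f T" "trunc' k T = f' T" "P.weight k T = weight T"
      using T by (simp_all add: trunc_eq trunc'_eq weight_eq B_def c_def)
    moreover have "trunc k t * ((1 - \<beta>\<^sup>2) / 2 * P.gain k t - 2 * trunc k 0 * D)
      \<le> trunc' k t * (P.trial k t)\<^sup>2 - trunc k t * P.trial_energy k t"
      using T by (intro P.stability_lower_bound[of T k \<epsilon> D t])
        (simp_all only: eqs trunc_0 \<epsilon>_def D_def that)
    ultimately show ?thesis by (simp only: trunc_0)
  qed
  have main: "c * (f t * P.gain k t) - C \<le> f' t * (P.trial k t)\<^sup>2 - f t * P.trial_energy k t"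
    if k: "S \<le> k" and t: "0 \<le> t" for k t
  proof (cases "t \<le> S")
    case True
    then have "t \<le> k" using k by simp
    have "f t * B \<le> \<bar>f t * B\<bar>" by simp
    also have "\<dots> \<le> C"
      unfolding C_def abs_mult using f_pos[OF t] f_mono[OF t True] by (intro mult_right_mono) auto
    finally have "f t * B \<le> C" .
    moreover have "f t * (c * P.gain k t) \<ge> 0"
      using f_pos[OF t] c P.gain_nonneg[OF t, of k] by simp
    moreover have "f t * (2 * c * P.gain k t - B) \<le> f' t * (P.trial k t)\<^sup>2 - f t * P.trial_energy k t"
      using lower[OF k t] t \<open>t \<le> k\<close> by (simp add: trunc_eq trunc'_eq)
    ultimately show ?thesis by (simp add: algebra_simps)
  next
    case False
    have "c * gain S \<le> c * P.gain k t"
      using P.gain_mono[of S t k] gain_eq[of S k] k False \<open>0 \<le> S\<close> c by simp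
    then have B: "c * P.gain k t \<le> 2 * c * P.gain k t - B" using BS by simp
    have p: "0 < trunc k t" using P.f_pos[OF t] .
    \<comment> \<open>All terms are multiplied by \<open>trunc k t\<close> in order to compare the logarithmic derivatives.\<close>
    have "trunc k t * (f t * (c * P.gain k t)) = f t * (trunc k t * (c * P.gain k t))" by simp
    also have "\<dots> \<le> f t * (trunc k t * (2 * c * P.gain k t - B))"
      using B p f_pos[OF t] by (intro mult_left_mono) auto
    also have "\<dots> \<le> f t * (trunc' k t * (P.trial k t)\<^sup>2 - trunc k t * P.trial_energy k t)"
      using lower[OF k t] f_pos[OF t] by (intro mult_left_mono) auto
    also have "\<dots> = (f t * trunc' k t) * (P.trial k t)\<^sup>2 - trunc k t * (f t * P.trial_energy k t)"
      by (simp add: algebra_simps)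
    also have "\<dots> \<le> (f' t * trunc k t) * (P.trial k t)\<^sup>2 - trunc k t * (f t * P.trial_energy k t)"
      using trunc_log_slope_le[OF t, of k] by (intro diff_right_mono mult_right_mono) auto
    also have "\<dots> = trunc k t * (f' t * (P.trial k t)\<^sup>2 - f t * P.trial_energy k t)"
      by (simp add: algebra_simps)
    finally have "f t * (c * P.gain k t) \<le> f' t * (P.trial k t)\<^sup>2 - f t * P.trial_energy k t"
      using p by simp
    moreover have "0 \<le> C" by (simp add: C_def)
    ultimately show ?thesis by (simp add: algebra_simps)
  qed
  have bdd: "bounded (P.trial' k ` {0..})" if "0 \<le> k" for k
  proof -
    \<comment> \<open>Beyond \<open>k + 1\<close> the truncation is affine and its weight is constant.\<close>
    have const: "P.trial' k t = P.trial' k (k+1)" if "k + 1 \<le> t" for t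
    proof -
      have z: "trunc'' k s = 0" if "k + 1 \<le> s" for s
        using that by (simp add: trunc''_def cutoff_def)
      then have r: "P.rate k s = 0" if "k + 1 \<le> s" for s
        using that by (simp add: P.rate_def)
      have "trunc' k t \<le> trunc' k (k+1)" "P.weight k t \<le> P.weight k (k+1)"
      proof -
        have "- trunc' k (k+1) \<le> - trunc' k t"
        proof (rule nondecreasing_half_line[of "k+1" t "\<lambda>s. - trunc' k s" "\<lambda>s. - trunc'' k s"])
          show "((\<lambda>s. - trunc' k s) has_real_derivative - trunc'' k s) (at s within {0..})"
            if "k + 1 \<le> s" for s using that \<open>0 \<le> k\<close> by (intro DERIV_minus trunc'_deriv) simp
        qed (use that \<open>0 \<le> k\<close> z in auto)
        then show "trunc' k t \<le> trunc' k (k+1)" by simp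
        have "- P.weight k (k+1) \<le> - P.weight k t"
        proof (rule nondecreasing_half_line[of "k+1" t "\<lambda>s. - P.weight k s"
              "\<lambda>s. - (P.weight k s * (\<beta> * P.rate k s))"])
          show "((\<lambda>s. - P.weight k s) has_real_derivative - (P.weight k s * (\<beta> * P.rate k s)))
            (at s within {0..})"
            if "k + 1 \<le> s" for s using that \<open>0 \<le> k\<close> by (intro DERIV_minus P.weight_deriv) simp
        qed (use that \<open>0 \<le> k\<close> r in auto)
        then show "P.weight k t \<le> P.weight k (k+1)" by simp
      qed
      moreover have "trunc' k (k+1) \<le> trunc' k t" "P.weight k (k+1) \<le> P.weight k t"
        using P.f'_mono[of "k+1" t k] P.weight_mono[of "k+1" t k] that \<open>0 \<le> k\<close> by auto
      ultimately show ?thesis using r[of t] r[of "k+1"] that by (simp add: P.trial'_def)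
    qed
    have "P.trial' k ` {0..} \<subseteq> P.trial' k ` {0..k+1}"
    proof
      fix y assume "y \<in> P.trial' k ` {0..}"
      then obtain t where t: "y = P.trial' k t" "0 \<le> t" by auto
      show "y \<in> P.trial' k ` {0..k+1}"
      proof (cases "t \<le> k + 1")
        case False
        then have "y = P.trial' k (k+1)" using const[of t] t by simp
        then show ?thesis using \<open>0 \<le> k\<close> by auto
      qed (use t in auto)
    qed
    moreover have "compact (P.trial' k ` {0..k+1})"
      by (intro compact_continuous_image continuous_on_subset[OF P.trial'_cont]) auto
    ultimately show ?thesis using bounded_subset compact_imp_bounded by blast
  qed
  have K: "S \<le> real k" if "K \<le> k" for k
    using that unfolding K_def by linarith
  show ?thesis
  proof (rule that[of c "\<lambda>k. P.trial (real k)" "\<lambda>k. P.trial' (real k)" "\<lambda>k. P.trial_energy (real k)" K C])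
    show "- C \<le> f' t * (P.trial (real k) t)\<^sup>2 - f t * P.trial_energy (real k) t"
      if "K \<le> k" "0 \<le> t" for k t
    proof -
      have "0 \<le> c * (f t * P.gain (real k) t)"
        using c f_pos[OF \<open>0 \<le> t\<close>] P.gain_nonneg[OF \<open>0 \<le> t\<close>, of "real k"] by simp
      then show ?thesis using main[OF K[OF that(1)] that(2)] by simp
    qed
    show "c * H_fun f f'' \<beta> t - C \<le> f' t * (P.trial (real k) t)\<^sup>2 - f t * P.trial_energy (real k) t"
      if "K \<le> k" "0 \<le> t" "t \<le> real k" for k t
      using main[OF K[OF that(1)] that(2)] H_fun_eq_gain[OF that(2)] gain_eq[OF that(2,3)] by simp
  qed (auto simp: c P.trial_deriv P.trial_energy_deriv P.trial'_cont bdd P.trial_0 P.trial_energy_0)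
qed

end

section \<open>Square-integrable functions\<close>

lemma norm_add_squared_le:
  fixes a b :: "'a::real_normed_vector"
  shows "(norm (a + b))\<^sup>2 \<le> 2 * (norm a)\<^sup>2 + 2 * (norm b)\<^sup>2"
proof -
  have "(norm (a + b))\<^sup>2 \<le> (norm a + norm b)\<^sup>2"
    by (intro power_mono norm_triangle_ineq) auto
  also have "\<dots> \<le> 2 * (norm a)\<^sup>2 + 2 * (norm b)\<^sup>2"
    using zero_le_power2[of "norm a - norm b"] by (simp add: power2_eq_square algebra_simps)
  finally show ?thesis .
qed

lemma L2_measurable: "v \<in> L2 \<Omega> \<Longrightarrow> v \<in> borel_measurable (lebesgue_on \<Omega>)"
  and L2_integrable: "v \<in> L2 \<Omega> \<Longrightarrow> integrable (lebesgue_on \<Omega>) (\<lambda>x. (norm (v x))\<^sup>2)"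
  by (auto simp: L2_def)

lemma L2_mono:
  assumes "w \<in> L2 \<Omega>" "v \<in> borel_measurable (lebesgue_on \<Omega>)"
    and "AE x in lebesgue_on \<Omega>. norm (v x) \<le> norm (w x)"
  shows "v \<in> L2 \<Omega>"
proof -
  have [measurable]: "v \<in> borel_measurable (lebesgue_on \<Omega>)" by fact
  have "integrable (lebesgue_on \<Omega>) (\<lambda>x. (norm (v x))\<^sup>2)"
    by (rule Bochner_Integration.integrable_bound[OF L2_integrable[OF assms(1)]])
      (use assms(3) in \<open>auto intro!: power_mono elim!: eventually_mono\<close>)
  then show ?thesis by (simp add: L2_def)
qed

lemma L2_add:
  assumes "v \<in> L2 \<Omega>" "w \<in> L2 \<Omega>" shows "(\<lambda>x. v x + w x) \<in> L2 \<Omega>"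
proof -
  have [measurable]: "v \<in> borel_measurable (lebesgue_on \<Omega>)" "w \<in> borel_measurable (lebesgue_on \<Omega>)"
    using assms by (auto simp: L2_def)
  have "integrable (lebesgue_on \<Omega>) (\<lambda>x. (norm (v x + w x))\<^sup>2)"
    by (rule Bochner_Integration.integrable_bound
        [of _ "\<lambda>x. 2 * (norm (v x))\<^sup>2 + 2 * (norm (w x))\<^sup>2"])
      (use assms norm_add_squared_le in \<open>auto intro!: L2_integrable\<close>)
  then show ?thesis by (simp add: L2_def)
qed

lemma L2_scaleR: "v \<in> L2 \<Omega> \<Longrightarrow> (\<lambda>x. c *\<^sub>R v x) \<in> L2 \<Omega>"
  by (auto simp: L2_def power_mult_distrib)

lemma L2_diff: "v \<in> L2 \<Omega> \<Longrightarrow> w \<in> L2 \<Omega> \<Longrightarrow> (\<lambda>x. v x - w x) \<in> L2 \<Omega>"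
  using L2_add[of v \<Omega> "\<lambda>x. (-1) *\<^sub>R w x"] L2_scaleR[of w \<Omega> "-1"] by simp

lemma L2_norm: "v \<in> L2 \<Omega> \<Longrightarrow> (\<lambda>x. norm (v x)) \<in> L2 \<Omega>"
  by (auto simp: L2_def)

lemma L2_bounded:
  assumes "finite_measure (lebesgue_on \<Omega>)" "v \<in> borel_measurable (lebesgue_on \<Omega>)"
    and "\<And>x. x \<in> \<Omega> \<Longrightarrow> norm (v x) \<le> B"
  shows "v \<in> L2 \<Omega>"
proof -
  interpret finite_measure "lebesgue_on \<Omega>" by fact
  have [measurable]: "v \<in> borel_measurable (lebesgue_on \<Omega>)" by fact
  have "integrable (lebesgue_on \<Omega>) (\<lambda>x. (norm (v x))\<^sup>2)"
    by (rule integrable_const_bound[of _ "B\<^sup>2"])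
      (use assms(3) in \<open>auto intro!: power_mono\<close>)
  then show ?thesis by (simp add: L2_def)
qed

lemma L2_integrable_mult:
  assumes "v \<in> L2 \<Omega>" "w \<in> L2 \<Omega>"
  shows "integrable (lebesgue_on \<Omega>) (\<lambda>x. norm (v x) * norm (w x))"
proof (rule Bochner_Integration.integrable_bound)
  show "integrable (lebesgue_on \<Omega>) (\<lambda>x. (norm (v x))\<^sup>2 + (norm (w x))\<^sup>2)"
    using assms by (auto intro!: L2_integrable)
  have [measurable]: "v \<in> borel_measurable (lebesgue_on \<Omega>)" "w \<in> borel_measurable (lebesgue_on \<Omega>)"
    using assms by (auto simp: L2_def)
  show "(\<lambda>x. norm (v x) * norm (w x)) \<in> borel_measurable (lebesgue_on \<Omega>)" by measurable
  have "norm (v x) * norm (w x) \<le> (norm (v x))\<^sup>2 + (norm (w x))\<^sup>2" for x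
    using sum_squares_bound[of "norm (v x)" "norm (w x)"]
      mult_nonneg_nonneg[OF norm_ge_zero norm_ge_zero, of "v x" "w x"] by linarith
  then show "AE x in lebesgue_on \<Omega>. norm (norm (v x) * norm (w x)) \<le> norm ((norm (v x))\<^sup>2 + (norm (w x))\<^sup>2)"
    by auto
qed

lemma L2_integrable_inner:
  fixes v w :: "real^'n::finite \<Rightarrow> 'b::euclidean_space"
  assumes "v \<in> L2 \<Omega>" "w \<in> L2 \<Omega>"
  shows "integrable (lebesgue_on \<Omega>) (\<lambda>x. v x \<bullet> w x)"
proof (rule Bochner_Integration.integrable_bound[OF L2_integrable_mult[OF assms]])
  have [measurable]: "v \<in> borel_measurable (lebesgue_on \<Omega>)" "w \<in> borel_measurable (lebesgue_on \<Omega>)"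
    using assms by (auto simp: L2_def)
  show "(\<lambda>x. v x \<bullet> w x) \<in> borel_measurable (lebesgue_on \<Omega>)" by measurable
qed (use Cauchy_Schwarz_ineq2 in auto)

text \<open>
  Strong convergence to zero in \<open>L2\<close>; a sequence \<open>\<psi> k\<close> converges to \<open>v\<close> when \<open>\<psi> k - v\<close> is null.
\<close>

definition L2_null :: "(real^'n::finite) set \<Rightarrow> (nat \<Rightarrow> real^'n \<Rightarrow> 'b::euclidean_space) \<Rightarrow> bool" where
  "L2_null \<Omega> w \<longleftrightarrow>
     (\<forall>j. w j \<in> L2 \<Omega>) \<and> (\<lambda>j. LINT x|lebesgue_on \<Omega>. (norm (w j x))\<^sup>2) \<longlonglongrightarrow> 0"

lemma L2_null_L2: "L2_null \<Omega> w \<Longrightarrow> w j \<in> L2 \<Omega>"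
  and L2_null_lim: "L2_null \<Omega> w \<Longrightarrow> (\<lambda>j. LINT x|lebesgue_on \<Omega>. (norm (w j x))\<^sup>2) \<longlonglongrightarrow> 0"
  by (auto simp: L2_null_def)

lemma L2_null_mono:
  assumes "L2_null \<Omega> w" "\<And>j. v j \<in> borel_measurable (lebesgue_on \<Omega>)"
    and "\<And>j. AE x in lebesgue_on \<Omega>. norm (v j x) \<le> norm (w j x)"
  shows "L2_null \<Omega> v"
proof -
  have v: "v j \<in> L2 \<Omega>" for j
    using L2_mono[OF L2_null_L2[OF assms(1)] assms(2,3)] .
  have "(\<lambda>j. LINT x|lebesgue_on \<Omega>. (norm (v j x))\<^sup>2) \<longlonglongrightarrow> 0"
  proof (rule tendsto_sandwich[where f = "\<lambda>_. 0", OF _ _ tendsto_const])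
    show "(\<lambda>j. LINT x|lebesgue_on \<Omega>. (norm (w j x))\<^sup>2) \<longlonglongrightarrow> 0"
      by (rule L2_null_lim[OF assms(1)])
    show "\<forall>\<^sub>F j in sequentially. (LINT x|lebesgue_on \<Omega>. (norm (v j x))\<^sup>2)
        \<le> (LINT x|lebesgue_on \<Omega>. (norm (w j x))\<^sup>2)"
    proof (rule always_eventually, rule allI, rule integral_mono_AE)
      fix j
      show "AE x in lebesgue_on \<Omega>. (norm (v j x))\<^sup>2 \<le> (norm (w j x))\<^sup>2"
        using assms(3)[of j] by (auto intro: power_mono elim!: eventually_mono)
    qed (use v assms(1) in \<open>auto intro: L2_integrable L2_null_L2\<close>)
  qed simp
  with v show ?thesis by (simp add: L2_null_def)
qed

lemma L2_null_add:
  assumes "L2_null \<Omega> v" "L2_null \<Omega> w" shows "L2_null \<Omega> (\<lambda>j x. v j x + w j x)"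
proof -
  note L = L2_null_L2[OF assms(1)] L2_null_L2[OF assms(2)]
  have "(\<lambda>j. LINT x|lebesgue_on \<Omega>. (norm (v j x + w j x))\<^sup>2) \<longlonglongrightarrow> 0"
  proof (rule tendsto_sandwich[where f = "\<lambda>_. 0", OF _ _ tendsto_const])
    show "(\<lambda>j. 2 * (LINT x|lebesgue_on \<Omega>. (norm (v j x))\<^sup>2)
       + 2 * (LINT x|lebesgue_on \<Omega>. (norm (w j x))\<^sup>2)) \<longlonglongrightarrow> 0"
      using tendsto_add[OF tendsto_mult[OF tendsto_const L2_null_lim[OF assms(1)]]
          tendsto_mult[OF tendsto_const L2_null_lim[OF assms(2)]], of 2 2] by simp
    have "(LINT x|lebesgue_on \<Omega>. (norm (v j x + w j x))\<^sup>2)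
      \<le> (LINT x|lebesgue_on \<Omega>. 2 * (norm (v j x))\<^sup>2 + 2 * (norm (w j x))\<^sup>2)" for j
      using L by (intro integral_mono L2_integrable L2_add norm_add_squared_le
        Bochner_Integration.integrable_add integrable_mult_right)
    then show "\<forall>\<^sub>F j in sequentially. (LINT x|lebesgue_on \<Omega>. (norm (v j x + w j x))\<^sup>2)
      \<le> 2 * (LINT x|lebesgue_on \<Omega>. (norm (v j x))\<^sup>2) + 2 * (LINT x|lebesgue_on \<Omega>. (norm (w j x))\<^sup>2)"
      using L by (auto simp: L2_integrable)
  qed auto
  with L show ?thesis by (auto simp: L2_null_def intro: L2_add)
qed

lemma L2_null_scaleR_left:
  assumes "c \<longlonglongrightarrow> 0" "w \<in> L2 \<Omega>" shows "L2_null \<Omega> (\<lambda>j x. c j *\<^sub>R w x)"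
  using tendsto_mult[OF tendsto_power[OF assms(1), of 2] tendsto_const] L2_scaleR[OF assms(2)]
  by (auto simp: L2_null_def power_mult_distrib)

lemma L2_null_scaleR: "L2_null \<Omega> w \<Longrightarrow> L2_null \<Omega> (\<lambda>j x. c *\<^sub>R w j x)"
  using tendsto_mult[OF tendsto_const L2_null_lim, of \<Omega> w "c\<^sup>2"] L2_scaleR[of _ \<Omega> c]
  by (auto simp: L2_null_def power_mult_distrib)

lemma L2_null_norm: "L2_null \<Omega> w \<Longrightarrow> L2_null \<Omega> (\<lambda>j x. norm (w j x))"
  by (auto simp: L2_null_def L2_norm)

lemma L2_null_subseq: "L2_null \<Omega> w \<Longrightarrow> strict_mono r \<Longrightarrow> L2_null \<Omega> (\<lambda>j. w (r j))"
  unfolding L2_null_def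
  using LIMSEQ_subseq_LIMSEQ[of "\<lambda>j. LINT x|lebesgue_on \<Omega>. (norm (w j x))\<^sup>2" 0 r] by (auto simp: o_def)

lemma L2_null_AE_subseq:
  assumes "L2_null \<Omega> w"
  obtains r :: "nat \<Rightarrow> nat" where "strict_mono r" "AE x in lebesgue_on \<Omega>. (\<lambda>j. w (r j) x) \<longlonglongrightarrow> 0"
proof -
  have "\<exists>r::nat\<Rightarrow>nat. strict_mono r \<and> (AE x in lebesgue_on \<Omega>. (\<lambda>j. (norm (w (r j) x))\<^sup>2) \<longlonglongrightarrow> 0)"
    using L2_null_lim[OF assms] L2_integrable[OF L2_null_L2[OF assms]]
    by (intro tendsto_L1_AE_subseq) auto
  then obtain r :: "nat \<Rightarrow> nat" where r: "strict_mono r"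
    "AE x in lebesgue_on \<Omega>. (\<lambda>j. (norm (w (r j) x))\<^sup>2) \<longlonglongrightarrow> 0" by blast
  have "AE x in lebesgue_on \<Omega>. (\<lambda>j. w (r j) x) \<longlonglongrightarrow> 0"
    using r(2)
  proof eventually_elim
    case (elim x)
    then have "(\<lambda>j. sqrt ((norm (w (r j) x))\<^sup>2)) \<longlonglongrightarrow> sqrt 0" by (rule tendsto_real_sqrt)
    then show ?case by (simp add: tendsto_norm_zero_iff)
  qed
  with r(1) show ?thesis by (rule that)
qed

lemma L2_null_dominated:
  assumes "h \<in> L2 \<Omega>" "\<And>j. v j \<in> borel_measurable (lebesgue_on \<Omega>)"
    and "\<And>j. AE x in lebesgue_on \<Omega>. norm (v j x) \<le> norm (h x)"
    and "AE x in lebesgue_on \<Omega>. (\<lambda>j. v j x) \<longlonglongrightarrow> 0"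
  shows "L2_null \<Omega> v"
proof -
  have [measurable]: "\<And>j. v j \<in> borel_measurable (lebesgue_on \<Omega>)" by fact
  have "(\<lambda>j. LINT x|lebesgue_on \<Omega>. (norm (v j x))\<^sup>2) \<longlonglongrightarrow> (LINT x|lebesgue_on \<Omega>. 0)"
  proof (rule integral_dominated_convergence[OF _ _ L2_integrable[OF assms(1)]])
    show "AE x in lebesgue_on \<Omega>. (\<lambda>j. (norm (v j x))\<^sup>2) \<longlonglongrightarrow> 0"
      using assms(4)
    proof eventually_elim
      case (elim x)
      then have "(\<lambda>j. (norm (v j x))\<^sup>2) \<longlonglongrightarrow> 0\<^sup>2"
        by (intro tendsto_power tendsto_norm_zero)
      then show ?case by simp
    qed
    show "AE x in lebesgue_on \<Omega>. norm ((norm (v j x))\<^sup>2) \<le> (norm (h x))\<^sup>2" for j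
      using assms(3)[of j] by eventually_elim (auto intro: power_mono)
  qed auto
  then show ?thesis using L2_mono[OF assms(1,2,3)] by (auto simp: L2_null_def)
qed

lemma L2_null_pairing:
  assumes "h \<in> L2 \<Omega>" "L2_null \<Omega> w"
  shows "(\<lambda>j. LINT x|lebesgue_on \<Omega>. norm (h x) * norm (w j x)) \<longlonglongrightarrow> 0"
proof (rule tendstoI)
  fix e :: real assume e: "0 < e"
  define A where "A = (LINT x|lebesgue_on \<Omega>. (norm (h x))\<^sup>2)"
  have A: "0 \<le> A" by (simp add: A_def)
  define d where "d = e / (A + 1)"
  have d: "0 < d" using e A by (simp add: d_def)
  have "\<forall>\<^sub>F j in sequentially. (LINT x|lebesgue_on \<Omega>. (norm (w j x))\<^sup>2) < d * e"
    using order_tendstoD(2)[OF L2_null_lim[OF assms(2)]] d e by simp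
  then show "\<forall>\<^sub>F j in sequentially. dist (LINT x|lebesgue_on \<Omega>. norm (h x) * norm (w j x)) 0 < e"
  proof eventually_elim
    case (elim j)
    note w = L2_null_L2[OF assms(2), of j]
    \<comment> \<open>With \<open>d = e / (A + 1)\<close> the first summand integrates to less than \<open>e/2\<close> for every \<open>j\<close>.\<close>
    have "norm (h x) * norm (w j x) \<le> d / 2 * (norm (h x))\<^sup>2 + 1 / (2 * d) * (norm (w j x))\<^sup>2" for x
      using zero_le_power2[of "d * norm (h x) - norm (w j x)"] d
      by (simp add: field_simps power2_eq_square)
    then have "(LINT x|lebesgue_on \<Omega>. norm (h x) * norm (w j x))
      \<le> (LINT x|lebesgue_on \<Omega>. d / 2 * (norm (h x))\<^sup>2 + 1 / (2 * d) * (norm (w j x))\<^sup>2)"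
      using assms(1) w by (intro integral_mono L2_integrable_mult L2_integrable
        Bochner_Integration.integrable_add integrable_mult_right)
    also have "\<dots> = d / 2 * A + 1 / (2 * d) * (LINT x|lebesgue_on \<Omega>. (norm (w j x))\<^sup>2)"
      using assms(1) w by (simp add: A_def L2_integrable)
    also have "1 / (2 * d) * (LINT x|lebesgue_on \<Omega>. (norm (w j x))\<^sup>2) < e / 2"
      using elim d by (simp add: field_simps)
    also have "d / 2 * A \<le> e / 2"
      using A e by (simp add: d_def field_simps)
    finally show ?case by (simp add: dist_real_def)
  qed
qed

lemma L2_null_inner:
  fixes h :: "real^'n::finite \<Rightarrow> 'b::euclidean_space"
  assumes "h \<in> L2 \<Omega>" "L2_null \<Omega> w"
  shows "(\<lambda>j. LINT x|lebesgue_on \<Omega>. h x \<bullet> w j x) \<longlonglongrightarrow> 0"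
proof (rule Lim_null_comparison[OF always_eventually L2_null_pairing[OF assms]], intro allI)
  fix j
  have "norm (LINT x|lebesgue_on \<Omega>. h x \<bullet> w j x) \<le> (LINT x|lebesgue_on \<Omega>. norm (h x \<bullet> w j x))"
    by (rule integral_norm_bound)
  also have "\<dots> \<le> (LINT x|lebesgue_on \<Omega>. norm (h x) * norm (w j x))"
    using assms L2_null_L2 by (intro integral_mono integrable_norm L2_integrable_inner L2_integrable_mult)
      (auto simp: Cauchy_Schwarz_ineq2)
  finally show "norm (LINT x|lebesgue_on \<Omega>. h x \<bullet> w j x)
      \<le> (LINT x|lebesgue_on \<Omega>. norm (h x) * norm (w j x))" .
qed

section \<open>Smooth functions and test functions\<close>

lemma partial_deriv_eq:
  "(\<phi> has_derivative D) (at x) \<Longrightarrow> partial_deriv i \<phi> x = D (axis i 1)"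
  unfolding partial_deriv_def by (metis frechet_derivative_at)

lemma partial_deriv_const: "partial_deriv i (\<lambda>x. c) = (\<lambda>x. 0)"
  by (rule ext) (simp add: partial_deriv_eq[OF has_derivative_const])

lemma partial_deriv_add:
  assumes "\<phi> differentiable (at x)" "\<psi> differentiable (at x)"
  shows "partial_deriv i (\<lambda>x. \<phi> x + \<psi> x) x = partial_deriv i \<phi> x + partial_deriv i \<psi> x"
  using partial_deriv_eq[OF has_derivative_add[OF assms[unfolded frechet_derivative_works]]]
  by (simp add: partial_deriv_def)

lemma partial_deriv_mult:
  assumes "\<phi> differentiable (at x)" "\<psi> differentiable (at x)"
  shows "partial_deriv i (\<lambda>x. \<phi> x * \<psi> x) x = \<phi> x * partial_deriv i \<psi> x + partial_deriv i \<phi> x * \<psi> x"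
  using partial_deriv_eq[OF has_derivative_mult[OF assms[unfolded frechet_derivative_works]]]
  by (simp add: partial_deriv_def)

lemma C_k_const: "C_k k (\<lambda>x. c)"
  by (induction k arbitrary: c) (auto simp: partial_deriv_const)

text \<open>
  The recursion in \<open>C_k\<close> runs through the partial derivatives, so that the regularity of the function
  itself has to be recovered by induction, starting from: differentiable functions are continuous.
\<close>

lemma C_k_SucD: "C_k (Suc k) \<phi> \<Longrightarrow> C_k k \<phi>"
proof (induction k arbitrary: \<phi>)
  case 0
  then show ?case
    by (auto simp: continuous_on_eq_continuous_at differentiable_imp_continuous_within)
next
  case (Suc k)
  have "C_k k (partial_deriv i \<phi>)" for i
    using Suc.prems by (intro Suc.IH) simp
  then show ?case using Suc.prems by simp
qed

lemma C_k_add: "C_k k \<phi> \<Longrightarrow> C_k k \<psi> \<Longrightarrow> C_k k (\<lambda>x. \<phi> x + \<psi> x)"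
proof (induction k arbitrary: \<phi> \<psi>)
  case (Suc k)
  have "partial_deriv i (\<lambda>x. \<phi> x + \<psi> x) = (\<lambda>x. partial_deriv i \<phi> x + partial_deriv i \<psi> x)" for i
    using Suc.prems by (auto intro!: partial_deriv_add)
  then show ?case using Suc by (auto intro: differentiable_add)
qed (auto intro: continuous_intros)

lemma C_k_mult: "C_k k \<phi> \<Longrightarrow> C_k k \<psi> \<Longrightarrow> C_k k (\<lambda>x. \<phi> x * \<psi> x)"
proof (induction k arbitrary: \<phi> \<psi>)
  case (Suc k)
  have "partial_deriv i (\<lambda>x. \<phi> x * \<psi> x)
      = (\<lambda>x. \<phi> x * partial_deriv i \<psi> x + partial_deriv i \<phi> x * \<psi> x)" for i
    using Suc.prems by (auto intro!: partial_deriv_mult)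
  moreover have "C_k k (\<lambda>x. \<phi> x * partial_deriv i \<psi> x + partial_deriv i \<phi> x * \<psi> x)" for i
    using Suc.prems C_k_SucD[OF Suc.prems(1)] C_k_SucD[OF Suc.prems(2)]
    by (intro C_k_add Suc.IH) simp_all
  ultimately show ?case using Suc.prems by (auto intro: differentiable_mult)
qed (auto intro: continuous_intros)

lemma smooth_const: "smooth (\<lambda>x. c)"
  and smooth_add: "smooth \<phi> \<Longrightarrow> smooth \<psi> \<Longrightarrow> smooth (\<lambda>x. \<phi> x + \<psi> x)"
  and smooth_mult: "smooth \<phi> \<Longrightarrow> smooth \<psi> \<Longrightarrow> smooth (\<lambda>x. \<phi> x * \<psi> x)"
  by (auto simp: smooth_def C_k_const C_k_add C_k_mult)

lemma smooth_polynomial: "real_polynomial_function P \<Longrightarrow> smooth \<phi> \<Longrightarrow> smooth (\<lambda>x. P (\<phi> x))"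
  for P :: "real \<Rightarrow> real"
proof (induction P rule: real_polynomial_function.induct)
  case (linear P)
  have "P (\<phi> x) = \<phi> x * P 1" for x
    using linear_cmul[OF bounded_linear.linear[OF linear(1)], of "\<phi> x" 1] by simp
  then have "(\<lambda>x. P (\<phi> x)) = (\<lambda>x. \<phi> x * P 1)" by (rule ext)
  then show ?case using linear by (simp add: smooth_mult smooth_const)
qed (simp_all add: smooth_const smooth_add smooth_mult)

lemma smooth_differentiable: "smooth \<phi> \<Longrightarrow> \<phi> differentiable (at x)"
  unfolding smooth_def by (drule spec[of _ "Suc 0"]) simp

lemma smooth_continuous: "smooth \<phi> \<Longrightarrow> continuous_on UNIV \<phi>"
  unfolding smooth_def by (drule spec[of _ 0]) simp

lemma smooth_partial_deriv_continuous: "smooth \<phi> \<Longrightarrow> continuous_on UNIV (partial_deriv i \<phi>)"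
  unfolding smooth_def by (drule spec[of _ "Suc 0"]) simp

lemma smooth_gradient_continuous: "smooth \<phi> \<Longrightarrow> continuous_on UNIV (gradient \<phi>)"
  unfolding gradient_def using smooth_partial_deriv_continuous[of \<phi>]
  by (intro continuous_on_vec_lambda) (simp add: eta_contract_eq)

lemma gradient_compose:
  assumes "(P has_real_derivative p) (at (\<phi> x))" "\<phi> differentiable (at x)"
  shows "gradient (\<lambda>x. P (\<phi> x)) x = p *\<^sub>R gradient \<phi> x"
proof -
  have "(\<phi> has_derivative frechet_derivative \<phi> (at x)) (at x)"
    using assms(2) by (simp add: frechet_derivative_works)
  then have "((\<lambda>x. P (\<phi> x)) has_derivative (\<lambda>h. p * frechet_derivative \<phi> (at x) h)) (at x)"
    using assms(1) unfolding has_field_derivative_def by (rule has_derivative_compose)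
  from partial_deriv_eq[OF this] show ?thesis
    by (simp add: gradient_def vec_eq_iff) (simp add: partial_deriv_def)
qed

lemma gradient_diff:
  assumes "\<phi> differentiable (at x)" "\<psi> differentiable (at x)"
  shows "gradient (\<lambda>x. \<phi> x - \<psi> x) x = gradient \<phi> x - gradient \<psi> x"
  using partial_deriv_eq[OF has_derivative_diff[OF assms[unfolded frechet_derivative_works]]]
  by (simp add: gradient_def vec_eq_iff) (simp add: partial_deriv_def)

lemma test_smooth: "\<phi> \<in> test_functions \<Omega> \<Longrightarrow> smooth \<phi>"
  and test_compact_support: "\<phi> \<in> test_functions \<Omega> \<Longrightarrow> compact (closure {x. \<phi> x \<noteq> 0})"
  and test_support_subset: "\<phi> \<in> test_functions \<Omega> \<Longrightarrow> closure {x. \<phi> x \<noteq> 0} \<subseteq> \<Omega>"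
  by (auto simp: test_functions_def)

lemmas test_differentiable = smooth_differentiable[OF test_smooth]

lemma zero_outside_support: "x \<notin> closure {x. \<phi> x \<noteq> 0} \<Longrightarrow> \<phi> x = 0"
  using closure_subset[of "{x. \<phi> x \<noteq> 0}"] by auto

lemma partial_deriv_outside_support:
  assumes "x \<notin> closure {x. \<phi> x \<noteq> 0}" shows "partial_deriv i \<phi> x = 0"
proof -
  have "(\<phi> has_derivative (\<lambda>_. 0)) (at x)"
    by (rule has_derivative_transform_within_open[of "\<lambda>_. 0" _ _ _ "- closure {x. \<phi> x \<noteq> 0}"])
      (use assms zero_outside_support in auto)
  from partial_deriv_eq[OF this] show ?thesis .
qed

lemma gradient_outside_support:
  "x \<notin> closure {x. \<phi> x \<noteq> 0} \<Longrightarrow> gradient \<phi> x = 0"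
  by (simp add: gradient_def vec_eq_iff partial_deriv_outside_support)

lemma test_functionsI:
  assumes "smooth \<psi>" "\<phi> \<in> test_functions \<Omega>" "\<And>x. \<phi> x = 0 \<Longrightarrow> \<psi> x = 0"
  shows "\<psi> \<in> test_functions \<Omega>"
proof -
  have "closure {x. \<psi> x \<noteq> 0} \<subseteq> closure {x. \<phi> x \<noteq> 0}"
    by (rule closure_mono) (use assms(3) in auto)
  moreover have "bounded {x. \<psi> x \<noteq> 0}"
    by (rule bounded_subset[of "{x. \<phi> x \<noteq> 0}"])
      (use assms(3) test_compact_support[OF assms(2)] in auto)
  ultimately show ?thesis
    using assms(1) test_support_subset[OF assms(2)] by (auto simp: test_functions_def)
qed

lemma test_mult:
  "\<phi> \<in> test_functions \<Omega> \<Longrightarrow> \<psi> \<in> test_functions \<Omega> \<Longrightarrow> (\<lambda>x. \<phi> x * \<psi> x) \<in> test_functions \<Omega>"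
  by (rule test_functionsI[of _ \<phi>]) (auto intro: smooth_mult test_smooth)

lemma test_polynomial:
  "\<phi> \<in> test_functions \<Omega> \<Longrightarrow> real_polynomial_function P \<Longrightarrow> P 0 = 0 \<Longrightarrow> (\<lambda>x. P (\<phi> x)) \<in> test_functions \<Omega>"
  by (rule test_functionsI[of _ \<phi>]) (auto intro: smooth_polynomial test_smooth)

lemma test_diff:
  assumes "\<phi> \<in> test_functions \<Omega>" "\<psi> \<in> test_functions \<Omega>"
  shows "(\<lambda>x. \<phi> x - \<psi> x) \<in> test_functions \<Omega>"
proof -
  let ?S = "\<lambda>\<phi>. {x::real^'a. \<phi> x \<noteq> (0::real)}"
  have "smooth (\<lambda>x. \<phi> x + (-1) * \<psi> x)"
    using assms by (intro smooth_add smooth_mult smooth_const test_smooth)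
  moreover have "closure (?S (\<lambda>x. \<phi> x - \<psi> x)) \<subseteq> closure (?S \<phi>) \<union> closure (?S \<psi>)"
    unfolding closure_Un[symmetric] by (rule closure_mono) auto
  moreover have "bounded (?S (\<lambda>x. \<phi> x - \<psi> x))"
    by (rule bounded_subset[of "?S \<phi> \<union> ?S \<psi>"])
      (use test_compact_support[OF assms(1)] test_compact_support[OF assms(2)] in auto)
  ultimately show ?thesis
    using test_support_subset[OF assms(1)] test_support_subset[OF assms(2)]
    by (auto simp: test_functions_def)
qed

lemma bounded_of_compact_support:
  fixes h :: "'a::topological_space \<Rightarrow> 'b::real_normed_vector"
  assumes "compact K" "continuous_on UNIV h" "\<And>x. x \<notin> K \<Longrightarrow> h x = 0"
  obtains B where "\<And>x. norm (h x) \<le> B"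
proof -
  have "bounded (h ` K)"
    using assms by (intro compact_imp_bounded compact_continuous_image)
      (auto intro: continuous_on_subset)
  then obtain B where B: "\<And>x. x \<in> K \<Longrightarrow> norm (h x) \<le> B"
    by (auto simp: bounded_iff)
  show ?thesis
  proof (rule that[of "max 0 B"])
    show "norm (h x) \<le> max 0 B" for x
      using B[of x] assms(3)[of x] by (cases "x \<in> K") auto
  qed
qed

lemma test_bounded:
  assumes "\<phi> \<in> test_functions \<Omega>" obtains B where "\<And>x. \<bar>\<phi> x\<bar> \<le> B"
  using bounded_of_compact_support[OF test_compact_support[OF assms]
      smooth_continuous[OF test_smooth[OF assms]] zero_outside_support[of _ \<phi>]] by auto

lemma test_gradient_bounded:
  assumes "\<phi> \<in> test_functions \<Omega>" obtains B where "\<And>x. norm (gradient \<phi> x) \<le> B"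
  using bounded_of_compact_support[OF test_compact_support[OF assms]
      smooth_gradient_continuous[OF test_smooth[OF assms]] gradient_outside_support[of _ \<phi>]] by auto

lemma continuous_measurable_lebesgue_on:
  fixes h :: "'a::euclidean_space \<Rightarrow> 'b::euclidean_space"
  assumes "open \<Omega>" "continuous_on UNIV h"
  shows "h \<in> borel_measurable (lebesgue_on \<Omega>)"
  using assms continuous_on_subset[OF assms(2), of \<Omega>]
  by (intro continuous_imp_measurable_on_sets_lebesgue) auto

lemma finite_measure_domain:
  "open \<Omega> \<Longrightarrow> bounded \<Omega> \<Longrightarrow> finite_measure (lebesgue_on \<Omega>)"
  by (intro finite_measure_lebesgue_on lmeasurable_open)

lemma test_L2:
  assumes "open \<Omega>" "bounded \<Omega>" "\<phi> \<in> test_functions \<Omega>"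
  shows "\<phi> \<in> L2 \<Omega>" "gradient \<phi> \<in> L2 \<Omega>" "partial_deriv i \<phi> \<in> L2 \<Omega>"
proof -
  note s = test_smooth[OF assms(3)]
  note fin = finite_measure_domain[OF assms(1,2)]
  obtain B where "\<And>x. \<bar>\<phi> x\<bar> \<le> B" using test_bounded[OF assms(3)] by blast
  then show "\<phi> \<in> L2 \<Omega>"
    using assms(1) s by (intro L2_bounded[OF fin] continuous_measurable_lebesgue_on smooth_continuous) auto
  obtain B where "\<And>x. norm (gradient \<phi> x) \<le> B" using test_gradient_bounded[OF assms(3)] by blast
  then show g: "gradient \<phi> \<in> L2 \<Omega>"
    using assms(1) s
    by (intro L2_bounded[OF fin] continuous_measurable_lebesgue_on smooth_gradient_continuous) auto
  have "\<bar>partial_deriv i \<phi> x\<bar> \<le> norm (gradient \<phi> x)" for x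
    using component_le_norm_cart[of "gradient \<phi> x" i] by (simp add: gradient_def)
  then show "partial_deriv i \<phi> \<in> L2 \<Omega>"
    using assms s by (intro L2_mono[OF g] continuous_measurable_lebesgue_on
        smooth_partial_deriv_continuous) auto
qed

lemma integral_lebesgue_on_eq_lborel:
  fixes h :: "'a::euclidean_space \<Rightarrow> real"
  assumes "open \<Omega>" "continuous_on UNIV h" "\<And>x. x \<notin> \<Omega> \<Longrightarrow> h x = 0"
  shows "(LINT x|lebesgue_on \<Omega>. h x) = (LINT x|lborel. h x)"
proof -
  have "(LINT x|lebesgue_on \<Omega>. h x) = (LINT x|lebesgue. indicator \<Omega> x *\<^sub>R h x)"
    using assms(1) by (intro integral_restrict_space) auto
  also have "(\<lambda>x. indicator \<Omega> x *\<^sub>R h x) = h"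
    using assms(3) by (auto simp: indicator_def fun_eq_iff)
  also have "(LINT x|lebesgue. h x) = (LINT x|lborel. h x)"
    using assms(2) by (intro integral_completion) (simp add: borel_measurable_continuous_onI)
  finally show ?thesis .
qed

lemma has_real_derivative_along_axis:
  assumes "\<phi> differentiable (at (x + s *\<^sub>R axis i 1))"
  shows "((\<lambda>s. \<phi> (x + s *\<^sub>R axis i 1)) has_real_derivative partial_deriv i \<phi> (x + s *\<^sub>R axis i 1)) (at s)"
proof -
  let ?D = "frechet_derivative \<phi> (at (x + s *\<^sub>R axis i 1))"
  have D: "(\<phi> has_derivative ?D) (at (x + s *\<^sub>R axis i 1))"
    using assms by (simp add: frechet_derivative_works)
  have "((\<lambda>s. x + s *\<^sub>R axis i 1) has_derivative (\<lambda>h. h *\<^sub>R axis i 1)) (at s)"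
    by (auto intro!: derivative_eq_intros)
  from has_derivative_compose[OF this D]
  have "((\<lambda>s. \<phi> (x + s *\<^sub>R axis i 1)) has_derivative (\<lambda>h. ?D (h *\<^sub>R axis i 1))) (at s)" .
  moreover have "?D (h *\<^sub>R axis i 1) = partial_deriv i \<phi> (x + s *\<^sub>R axis i 1) * h" for h
    using linear_cmul[OF has_derivative_linear[OF D]] by (simp add: partial_deriv_def mult.commute)
  ultimately show ?thesis by (simp add: has_field_derivative_def)
qed

lemma integrable_indicator_cball:
  fixes c :: "'a::euclidean_space" and B r :: real
  shows "integrable lborel (\<lambda>x. B * indicator (cball c r) x)"
proof -
  have "emeasure lborel (cball c r) < \<infinity>" by (intro emeasure_bounded_finite bounded_cball)
  then show ?thesis by (intro integrable_mult_right integrable_real_indicator) simp_all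
qed

text \<open>
  By translation invariance the difference quotients of \<open>\<phi>\<close> have integral zero. By the mean value theorem
  they are bounded, and they vanish outside a fixed ball, so that dominated convergence applies.
\<close>

lemma integral_partial_deriv_test:
  assumes "open \<Omega>" "\<phi> \<in> test_functions \<Omega>"
  shows "(LINT x|lebesgue_on \<Omega>. partial_deriv i \<phi> x) = 0"
proof -
  define e :: "real^'a" where "e = axis i 1"
  define K where "K = closure {x. \<phi> x \<noteq> 0}"
  note s = test_smooth[OF assms(2)]
  have K: "compact K" "K \<subseteq> \<Omega>"
    using test_compact_support[OF assms(2)] test_support_subset[OF assms(2)] by (auto simp: K_def)
  obtain B where B: "\<And>x. norm (gradient \<phi> x) \<le> B" using test_gradient_bounded[OF assms(2)] by blast
  then have pB: "\<bar>partial_deriv i \<phi> x\<bar> \<le> B" for x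
    using order_trans[OF component_le_norm_cart[of "gradient \<phi> x" i] B] by (simp add: gradient_def)
  obtain R where R: "\<And>x. x \<in> K \<Longrightarrow> norm x \<le> R"
    using compact_imp_bounded[OF K(1)] by (auto simp: bounded_iff)
  define t where "t k = inverse (real (Suc k))" for k
  have t: "0 < t k" "t k \<le> 1" for k by (auto simp: t_def field_simps)
  define d where "d k x = (\<phi> (x + t k *\<^sub>R e) - \<phi> x) / t k" for k x
  have cont [continuous_intros]: "continuous_on A \<phi>" for A
    using smooth_continuous[OF s] continuous_on_subset by blast
  have [measurable]: "\<phi> \<in> borel_measurable borel"
    using cont by (intro borel_measurable_continuous_onI)
  have [measurable]: "partial_deriv i \<phi> \<in> borel_measurable borel"
    using s by (intro borel_measurable_continuous_onI smooth_partial_deriv_continuous)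
  \<comment> \<open>The enlarged radius covers all translates, as the step \<open>t k\<close> is at most \<open>1\<close>.\<close>
  have dbound: "norm (d k x) \<le> B * indicator (cball 0 (R + 1)) x" for k x
  proof (cases "x \<in> cball 0 (R + 1)")
    case True
    have "\<exists>z>0. z < t k \<and> \<phi> (x + t k *\<^sub>R axis i 1) - \<phi> (x + 0 *\<^sub>R axis i 1)
        = (t k - 0) * partial_deriv i \<phi> (x + z *\<^sub>R axis i 1)"
      using t by (intro MVT2 has_real_derivative_along_axis test_differentiable[OF assms(2)])
    then obtain z where "\<phi> (x + t k *\<^sub>R e) - \<phi> x = t k * partial_deriv i \<phi> (x + z *\<^sub>R e)"
      by (auto simp: e_def)
    then have "d k x = partial_deriv i \<phi> (x + z *\<^sub>R e)" using t[of k] by (simp add: d_def)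
    then show ?thesis using True pB by simp
  next
    case False
    then have n: "R + 1 < norm x" by simp
    then have "x \<notin> K" using R[of x] by auto
    moreover have "x + t k *\<^sub>R e \<notin> K"
    proof
      assume "x + t k *\<^sub>R e \<in> K"
      then have "norm (x + t k *\<^sub>R e) \<le> R" by (rule R)
      moreover have "norm x \<le> norm (x + t k *\<^sub>R e) + norm (t k *\<^sub>R e)"
        using norm_triangle_ineq4[of "x + t k *\<^sub>R e" "t k *\<^sub>R e"] by simp
      moreover have "norm (t k *\<^sub>R e) \<le> 1" using t[of k] by (simp add: e_def)
      ultimately show False using n by simp
    qed
    ultimately have "\<phi> x = 0" "\<phi> (x + t k *\<^sub>R e) = 0"
      unfolding K_def by (auto intro: zero_outside_support)
    then have "d k x = 0" by (simp add: d_def)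
    then show ?thesis using False by simp
  qed
  have "(\<lambda>k. LINT x|lborel. d k x) \<longlonglongrightarrow> (LINT x|lborel. partial_deriv i \<phi> x)"
  proof (rule integral_dominated_convergence)
    show "integrable lborel (\<lambda>x::real^'a. B * indicator (cball 0 (R + 1)) x)"
      by (rule integrable_indicator_cball)
    show "AE x in lborel. (\<lambda>k. d k x) \<longlonglongrightarrow> partial_deriv i \<phi> x"
    proof (rule AE_I2)
      fix x
      have "((\<lambda>s. \<phi> (x + s *\<^sub>R axis i 1)) has_real_derivative partial_deriv i \<phi> (x + 0 *\<^sub>R axis i 1)) (at 0)"
        by (intro has_real_derivative_along_axis test_differentiable[OF assms(2)])
      then have "(\<lambda>h. (\<phi> (x + h *\<^sub>R e) - \<phi> x) / h) \<midarrow>0\<rightarrow> partial_deriv i \<phi> x"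
        by (simp add: DERIV_def e_def)
      moreover have "filterlim t (at 0) sequentially"
        unfolding t_def using LIMSEQ_inverse_real_of_nat
        by (auto simp: filterlim_at)
      ultimately show "(\<lambda>k. d k x) \<longlonglongrightarrow> partial_deriv i \<phi> x"
        unfolding d_def by (rule filterlim_compose)
    qed
    show "AE x in lborel. norm (d k x) \<le> B * indicator (cball 0 (R + 1)) x" for k
      using dbound by simp
    show "d k \<in> borel_measurable lborel" for k unfolding d_def by measurable
  qed simp
  moreover have "(LINT x|lborel. d k x) = 0" for k
  proof -
    obtain C where C: "\<And>x. \<bar>\<phi> x\<bar> \<le> C" using test_bounded[OF assms(2)] by blast
    have int: "integrable lborel \<phi>"
    proof (rule Bochner_Integration.integrable_bound)
      show "AE x in lborel. norm (\<phi> x) \<le> norm (C * indicator (cball 0 R) x)"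
      proof (rule AE_I2)
        show "norm (\<phi> x) \<le> norm (C * indicator (cball 0 R) x)" for x
        proof (cases "x \<in> K")
          case False
          then have "\<phi> x = 0" unfolding K_def by (rule zero_outside_support)
          then show ?thesis by simp
        qed (use C[of x] R[of x] in auto)
      qed
      show "integrable lborel (\<lambda>x::real^'a. C * indicator (cball 0 R) x)"
        by (rule integrable_indicator_cball)
    qed simp
    have "integrable (distr lborel borel ((+) (t k *\<^sub>R e))) \<phi>" using int by (simp add: lborel_distr_plus)
    then have int': "integrable lborel (\<lambda>x. \<phi> (x + t k *\<^sub>R e))"
      by (subst (asm) integrable_distr_eq) (auto simp: add.commute)
    have "(LINT x|lborel. \<phi> x) = (LINT x|distr lborel borel ((+) (t k *\<^sub>R e)). \<phi> x)"
      by (simp add: lborel_distr_plus)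
    also have "\<dots> = (LINT x|lborel. \<phi> (x + t k *\<^sub>R e))"
      by (subst integral_distr) (auto simp: add.commute)
    finally show ?thesis unfolding d_def using int int' by simp
  qed
  ultimately have "(LINT x|lborel. partial_deriv i \<phi> x) = 0"
    by (simp add: LIMSEQ_const_iff)
  then show ?thesis
    using K(2) assms(1) smooth_partial_deriv_continuous[OF s]
    by (subst integral_lebesgue_on_eq_lborel)
      (auto simp: K_def intro!: partial_deriv_outside_support)
qed

text \<open>
  The product of two test functions is a test function, whose derivative has integral zero.
\<close>

lemma test_integration_by_parts:
  assumes "open \<Omega>" "bounded \<Omega>" and t: "\<phi> \<in> test_functions \<Omega>" "\<psi> \<in> test_functions \<Omega>"
  shows "(LINT x|lebesgue_on \<Omega>. \<psi> x * partial_deriv i \<phi> x)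
       = - (LINT x|lebesgue_on \<Omega>. gradient \<psi> x $ i * \<phi> x)"
proof -
  have "partial_deriv i (\<lambda>x. \<psi> x * \<phi> x) = (\<lambda>x. \<psi> x * partial_deriv i \<phi> x + partial_deriv i \<psi> x * \<phi> x)"
    by (intro ext partial_deriv_mult test_differentiable[OF t(1)] test_differentiable[OF t(2)])
  moreover have "integrable (lebesgue_on \<Omega>) (\<lambda>x. \<psi> x \<bullet> partial_deriv i \<phi> x)"
    "integrable (lebesgue_on \<Omega>) (\<lambda>x. partial_deriv i \<psi> x \<bullet> \<phi> x)"
    using assms by (intro L2_integrable_inner test_L2; simp)+
  ultimately show ?thesis
    using integral_partial_deriv_test[OF assms(1) test_mult[OF t(2,1)], of i]
    by (simp add: gradient_def)
qed

section \<open>The Sobolev space of functions with zero boundary values\<close>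

lemma L2_imp_integrable:
  fixes v :: "real^'n::finite \<Rightarrow> real"
  assumes "finite_measure (lebesgue_on \<Omega>)" "v \<in> L2 \<Omega>"
  shows "integrable (lebesgue_on \<Omega>) v"
proof -
  have "(\<lambda>x. 1::real) \<in> L2 \<Omega>" by (rule L2_bounded[OF assms(1), of _ 1]) auto
  from L2_integrable_inner[OF assms(2) this] show ?thesis by simp
qed

lemma L2_imp_locally_integrable:
  assumes "finite_measure (lebesgue_on \<Omega>)" "open \<Omega>" "v \<in> L2 \<Omega>"
  shows "locally_integrable \<Omega> v"
  unfolding locally_integrable_def
proof (intro allI impI)
  fix K assume K: "compact K \<and> K \<subseteq> \<Omega>"
  have "set_integrable lebesgue \<Omega> v"
    using L2_imp_integrable[OF assms(1,3)] assms(2)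
    by (subst (asm) integrable_restrict_space) (auto simp: set_integrable_def)
  then have "set_integrable lebesgue K v"
    by (rule set_integrable_subset) (use K in \<open>auto simp: compact_imp_closed\<close>)
  then show "integrable (lebesgue_on K) v"
    using K by (subst integrable_restrict_space) (auto simp: set_integrable_def compact_imp_closed)
qed

text \<open>
  \<open>Dv\<close> is automatically the weak gradient of \<open>v\<close>: integration by parts holds for the approximating test
  functions and passes to the limit.
\<close>

lemma H10I:
  assumes "open \<Omega>" "bounded \<Omega>" "v \<in> L2 \<Omega>" "Dv \<in> L2 \<Omega>" "\<And>k. \<psi> k \<in> test_functions \<Omega>"
    and n: "L2_null \<Omega> (\<lambda>k x. \<psi> k x - v x)" "L2_null \<Omega> (\<lambda>k x. gradient (\<psi> k) x - Dv x)"
  shows "(v, Dv) \<in> H10 \<Omega>"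
proof -
  note fin = finite_measure_domain[OF assms(1,2)]
  have Dvi: "(\<lambda>x. Dv x $ i) \<in> L2 \<Omega>" for i
  proof (rule L2_mono[OF assms(4)])
    have [measurable]: "Dv \<in> borel_measurable (lebesgue_on \<Omega>)" using L2_measurable[OF assms(4)] .
    show "(\<lambda>x. Dv x $ i) \<in> borel_measurable (lebesgue_on \<Omega>)"
      unfolding cart_eq_inner_axis by measurable
  qed (use component_le_norm_cart[of "Dv x" i for x] in auto)
  have "(LINT x|lebesgue_on \<Omega>. v x * partial_deriv i \<phi> x) = - (LINT x|lebesgue_on \<Omega>. Dv x $ i * \<phi> x)"
    if \<phi>: "\<phi> \<in> test_functions \<Omega>" for \<phi> i
  proof (rule LIMSEQ_unique)
    note L = test_L2[OF assms(1,2)]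
    have "(\<lambda>k. LINT x|lebesgue_on \<Omega>. partial_deriv i \<phi> x \<bullet> (\<psi> k x - v x)) \<longlonglongrightarrow> 0"
      by (rule L2_null_inner[OF L(3)[OF \<phi>] n(1)])
    moreover have "(LINT x|lebesgue_on \<Omega>. partial_deriv i \<phi> x \<bullet> (\<psi> k x - v x))
       = (LINT x|lebesgue_on \<Omega>. \<psi> k x * partial_deriv i \<phi> x) - (LINT x|lebesgue_on \<Omega>. v x * partial_deriv i \<phi> x)" for k
      using L2_integrable_inner[OF L(1)[OF assms(5)[of k]] L(3)[OF \<phi>, of i]]
        L2_integrable_inner[OF assms(3) L(3)[OF \<phi>, of i]]
      by (simp add: right_diff_distrib mult.commute)
    ultimately show "(\<lambda>k. LINT x|lebesgue_on \<Omega>. \<psi> k x * partial_deriv i \<phi> x) \<longlonglongrightarrow>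
        (LINT x|lebesgue_on \<Omega>. v x * partial_deriv i \<phi> x)"
      by (simp add: LIM_zero_iff)
    have ax: "(\<lambda>x. \<phi> x *\<^sub>R axis i (1::real)) \<in> L2 \<Omega>"
      by (rule L2_mono[OF L(1)[OF \<phi>]]) (use L2_measurable[OF L(1)[OF \<phi>]] in auto)
    have "(\<lambda>k. LINT x|lebesgue_on \<Omega>. (\<phi> x *\<^sub>R axis i (1::real)) \<bullet> (gradient (\<psi> k) x - Dv x)) \<longlonglongrightarrow> 0"
      by (rule L2_null_inner[OF ax n(2)])
    moreover have "(LINT x|lebesgue_on \<Omega>. (\<phi> x *\<^sub>R axis i (1::real)) \<bullet> (gradient (\<psi> k) x - Dv x))
       = (LINT x|lebesgue_on \<Omega>. gradient (\<psi> k) x $ i * \<phi> x) - (LINT x|lebesgue_on \<Omega>. Dv x $ i * \<phi> x)" for k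
      using L2_integrable_inner[OF L(2)[OF assms(5)[of k]] ax] L2_integrable_inner[OF assms(4) ax]
      by (simp add: inner_diff_right inner_commute[of _ "axis i 1"] inner_axis' mult.commute right_diff_distrib
          inner_commute[of "gradient _ _"] inner_commute[of "Dv _"])
    ultimately have "(\<lambda>k. LINT x|lebesgue_on \<Omega>. gradient (\<psi> k) x $ i * \<phi> x) \<longlonglongrightarrow>
        (LINT x|lebesgue_on \<Omega>. Dv x $ i * \<phi> x)"
      by (simp add: LIM_zero_iff)
    from tendsto_minus[OF this]
    show "(\<lambda>k. LINT x|lebesgue_on \<Omega>. \<psi> k x * partial_deriv i \<phi> x) \<longlonglongrightarrow>
        - (LINT x|lebesgue_on \<Omega>. Dv x $ i * \<phi> x)"
      by (simp add: test_integration_by_parts[OF assms(1,2) \<phi> assms(5)])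
  qed
  then have "(v, Dv) \<in> H1 \<Omega>"
    using assms Dvi L2_imp_locally_integrable[OF fin assms(1)] by (auto simp: H1_def weak_gradient_def)
  moreover have "(\<lambda>k. (LINT x|lebesgue_on \<Omega>. (\<psi> k x - v x)\<^sup>2) +
          (LINT x|lebesgue_on \<Omega>. (norm (gradient (\<psi> k) x - Dv x))\<^sup>2)) \<longlonglongrightarrow> 0"
    using tendsto_add[OF L2_null_lim[OF n(1)] L2_null_lim[OF n(2)]] by simp
  ultimately show ?thesis using assms(5) by (auto simp: H10_def)
qed

lemma H10_L2: "(v, Dv) \<in> H10 \<Omega> \<Longrightarrow> v \<in> L2 \<Omega>" "(v, Dv) \<in> H10 \<Omega> \<Longrightarrow> Dv \<in> L2 \<Omega>"
  by (auto simp: H10_def H1_def)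

lemma H10E:
  assumes "open \<Omega>" "bounded \<Omega>" and v: "(v, Dv) \<in> H10 \<Omega>"
  obtains \<psi> where "\<And>k. \<psi> k \<in> test_functions \<Omega>"
    "L2_null \<Omega> (\<lambda>k x. \<psi> k x - v x)" "L2_null \<Omega> (\<lambda>k x. gradient (\<psi> k) x - Dv x)"
proof -
  obtain \<psi> :: "nat \<Rightarrow> real^'a \<Rightarrow> real" where \<psi>: "\<And>k. \<psi> k \<in> test_functions \<Omega>"
    and lim: "(\<lambda>k. (LINT x|lebesgue_on \<Omega>. (\<psi> k x - v x)\<^sup>2) +
          (LINT x|lebesgue_on \<Omega>. (norm (gradient (\<psi> k) x - Dv x))\<^sup>2)) \<longlonglongrightarrow> 0"
    using v by (auto simp: H10_def)
  note L = test_L2[OF assms(1,2) \<psi>] H10_L2[OF v]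
  have "(\<lambda>k. LINT x|lebesgue_on \<Omega>. (\<psi> k x - v x)\<^sup>2) \<longlonglongrightarrow> 0"
    by (rule tendsto_sandwich[OF _ _ tendsto_const lim]) auto
  moreover have "(\<lambda>k. LINT x|lebesgue_on \<Omega>. (norm (gradient (\<psi> k) x - Dv x))\<^sup>2) \<longlonglongrightarrow> 0"
    by (rule tendsto_sandwich[OF _ _ tendsto_const lim]) auto
  ultimately show ?thesis
    using \<psi> L by (intro that[of \<psi>]) (auto simp: L2_null_def intro!: L2_diff)
qed

lemma H10_test_diff:
  assumes "open \<Omega>" "bounded \<Omega>" and v: "(v, Dv) \<in> H10 \<Omega>" and \<phi>: "\<phi> \<in> test_functions \<Omega>"
  shows "(\<lambda>x. \<phi> x - v x, \<lambda>x. gradient \<phi> x - Dv x) \<in> H10 \<Omega>"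
proof -
  obtain \<psi> where \<psi>: "\<And>k. \<psi> k \<in> test_functions \<Omega>"
    "L2_null \<Omega> (\<lambda>k x. \<psi> k x - v x)" "L2_null \<Omega> (\<lambda>k x. gradient (\<psi> k) x - Dv x)"
    using H10E[OF assms(1-3)] by blast
  show ?thesis
  proof (rule H10I[OF assms(1,2), where \<psi> = "\<lambda>k x. \<phi> x - \<psi> k x"])
    show "L2_null \<Omega> (\<lambda>k x. \<phi> x - \<psi> k x - (\<phi> x - v x))"
      using L2_null_scaleR[OF \<psi>(2), of "-1"] by simp
    have "gradient (\<lambda>x. \<phi> x - \<psi> k x) x = gradient \<phi> x - gradient (\<psi> k) x" for k x
      by (intro gradient_diff test_differentiable[OF \<phi>] test_differentiable[OF \<psi>(1)])
    then show "L2_null \<Omega> (\<lambda>k x. gradient (\<lambda>x. \<phi> x - \<psi> k x) x - (gradient \<phi> x - Dv x))"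
      using L2_null_scaleR[OF \<psi>(3), of "-1"] by simp
    show "(\<lambda>x. \<phi> x - v x) \<in> L2 \<Omega>" "(\<lambda>x. gradient \<phi> x - Dv x) \<in> L2 \<Omega>"
      by (intro L2_diff test_L2[OF assms(1,2) \<phi>] H10_L2[OF v])+
    show "(\<lambda>x. \<phi> x - \<psi> k x) \<in> test_functions \<Omega>" for k
      by (rule test_diff[OF \<phi> \<psi>(1)])
  qed
qed

lemma test_H10:
  assumes "open \<Omega>" "bounded \<Omega>" "\<phi> \<in> test_functions \<Omega>"
  shows "(\<phi>, gradient \<phi>) \<in> H10 \<Omega>"
proof (rule H10I[OF assms(1,2), where \<psi> = "\<lambda>_. \<phi>"])
  have "(\<lambda>x. 0) \<in> L2 \<Omega>" by (rule L2_bounded[OF finite_measure_domain[OF assms(1,2)], of _ 0]) auto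
  then show "L2_null \<Omega> (\<lambda>k x. \<phi> x - \<phi> x)" by (simp add: L2_null_def)
  have "(\<lambda>x. 0) \<in> L2 \<Omega>" by (rule L2_bounded[OF finite_measure_domain[OF assms(1,2)], of _ 0]) auto
  then show "L2_null \<Omega> (\<lambda>k x. gradient \<phi> x - gradient \<phi> x)" by (simp add: L2_null_def)
qed (rule test_L2[OF assms] assms(3))+

text \<open>
  \<open>P\<close> is the primitive, vanishing at \<open>0\<close>, of a polynomial close to \<open>g'\<close>. The error of \<open>P\<close> is then
  at most \<open>e \<bar>t\<bar>\<close>, so that the \<open>L2\<close> norm of \<open>P(\<phi>) - g(\<phi>)\<close> is at most \<open>e\<close> times that of \<open>\<phi>\<close> whenever
  \<open>\<bar>\<phi>\<bar> \<le> R\<close>.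
\<close>

lemma polynomial_C1_approximation:
  fixes g g' :: "real \<Rightarrow> real"
  assumes g: "\<And>t. (g has_real_derivative g' t) (at t)" "continuous_on UNIV g'" "g 0 = 0"
    and "0 < e" "0 \<le> R"
  obtains P p where "real_polynomial_function P" "\<And>t. (P has_real_derivative p t) (at t)" "P 0 = 0"
    "\<And>t. \<bar>t\<bar> \<le> R \<Longrightarrow> \<bar>p t - g' t\<bar> \<le> e" "\<And>t. \<bar>t\<bar> \<le> R \<Longrightarrow> \<bar>P t - g t\<bar> \<le> e * \<bar>t\<bar>"
proof -
  obtain p where p: "real_polynomial_function p" "\<And>t. t \<in> {-R..R} \<Longrightarrow> \<bar>g' t - p t\<bar> < e"
    using Stone_Weierstrass_real_polynomial_function[of "{-R..R}" g' e]
      continuous_on_subset[OF g(2)] \<open>0 < e\<close> by auto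
  obtain c n where c: "p = (\<lambda>t. \<Sum>i\<le>n. c i * t ^ i)"
    using p(1) by (auto simp: real_polynomial_function_iff_sum)
  define P where "P = (\<lambda>t. \<Sum>i\<le>n. c i / real (Suc i) * t ^ Suc i)"
  have P: "(P has_real_derivative p t) (at t)" for t
  proof -
    have "(P has_real_derivative (\<Sum>i\<le>n. c i / real (Suc i) * (real (Suc i) * t ^ i))) (at t)"
      unfolding P_def by (intro DERIV_sum DERIV_cmult) (use DERIV_pow[of "Suc _" t] in auto)
    then show ?thesis by (simp add: c)
  qed
  have bound: "\<bar>P t - g t\<bar> \<le> e * \<bar>t\<bar>" if "\<bar>t\<bar> \<le> R" for t
  proof -
    have "norm ((P t - g t) - (P 0 - g 0)) \<le> e * norm (t - 0)"
    proof (rule field_differentiable_bound[of "{-R..R}"])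
      show "((\<lambda>t. P t - g t) has_field_derivative (p s - g' s)) (at s within {-R..R})" for s
        by (intro DERIV_subset[OF DERIV_diff[OF P g(1)]]) auto
      show "norm (p s - g' s) \<le> e" if "s \<in> {-R..R}" for s
        using p(2)[OF that] by (simp add: abs_minus_commute)
    qed (use that \<open>0 \<le> R\<close> in auto)
    then show ?thesis by (simp add: P_def g(3))
  qed
  show ?thesis
  proof (rule that[of P p])
    have "real_polynomial_function (\<lambda>t::real. t ^ Suc i)" for i
      by (intro real_polynomial_function_power) (simp add: real_polynomial_function.intros bounded_linear_ident)
    then show "real_polynomial_function P"
      unfolding P_def
      by (intro real_polynomial_function_sum real_polynomial_function.intros(4)
        real_polynomial_function.intros(2)) auto
    show "\<bar>p t - g' t\<bar> \<le> e" if "\<bar>t\<bar> \<le> R" for t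
      using p(2)[of t] that by (auto simp: abs_le_iff abs_minus_commute less_imp_le)
  qed (use P bound in \<open>auto simp: P_def\<close>)
qed

text \<open>
  Let test functions \<open>\<phi> k\<close> converge to \<open>u\<close>. Since the \<open>\<phi> k\<close> need not be uniformly bounded, each of them gets
  its own polynomial \<open>P k\<close>, accurate to \<open>1/(k+1)\<close> on the range of \<open>\<phi> k\<close>. Then \<open>P k (\<phi> k)\<close> are test functions
  that converge to \<open>g(u)\<close>; the gradients converge as well, where \<open>(g'(\<phi> k) - g'(u)) Du\<close> is treated by
  dominated convergence along a subsequence that converges almost everywhere.
\<close>

theorem H10_chain_rule:
  fixes g g' :: "real \<Rightarrow> real"
  assumes "open \<Omega>" "bounded \<Omega>" and u: "(u, Du) \<in> H10 \<Omega>"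
    and g: "\<And>t. (g has_real_derivative g' t) (at t)" "continuous_on UNIV g'" "g 0 = 0"
    and M: "\<And>t. \<bar>g' t\<bar> \<le> M"
  shows "(\<lambda>x. g (u x), \<lambda>x. g' (u x) *\<^sub>R Du x) \<in> H10 \<Omega>"
proof -
  obtain \<psi> where \<psi>: "\<And>k. \<psi> k \<in> test_functions \<Omega>"
    "L2_null \<Omega> (\<lambda>k x. \<psi> k x - u x)" "L2_null \<Omega> (\<lambda>k x. gradient (\<psi> k) x - Du x)"
    using H10E[OF assms(1-3)] by blast
  obtain r :: "nat \<Rightarrow> nat" where r: "strict_mono r"
    "AE x in lebesgue_on \<Omega>. (\<lambda>k. \<psi> (r k) x - u x) \<longlonglongrightarrow> 0"
    by (rule L2_null_AE_subseq[OF \<psi>(2)])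
  define \<phi> where "\<phi> k = \<psi> (r k)" for k
  have \<phi>: "\<phi> k \<in> test_functions \<Omega>" for k by (simp add: \<phi>_def \<psi>(1))
  have nu: "L2_null \<Omega> (\<lambda>k x. \<phi> k x - u x)"
    unfolding \<phi>_def by (rule L2_null_subseq[OF \<psi>(2) r(1)])
  have nD: "L2_null \<Omega> (\<lambda>k x. gradient (\<phi> k) x - Du x)"
    unfolding \<phi>_def by (rule L2_null_subseq[OF \<psi>(3) r(1)])
  have "\<exists>P p. real_polynomial_function P \<and> (\<forall>t. (P has_real_derivative p t) (at t)) \<and> P 0 = 0 \<and>
      (\<forall>x. \<bar>p (\<phi> k x) - g' (\<phi> k x)\<bar> \<le> inverse (real (Suc k))) \<and>
      (\<forall>x. \<bar>P (\<phi> k x) - g (\<phi> k x)\<bar> \<le> inverse (real (Suc k)) * \<bar>\<phi> k x\<bar>)" for k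
  proof -
    obtain B where B: "\<And>x. \<bar>\<phi> k x\<bar> \<le> B" using test_bounded[OF \<phi>] by blast
    have "0 \<le> B" using B[of 0] by linarith
    then obtain P p where "real_polynomial_function P" "\<And>t. (P has_real_derivative p t) (at t)" "P 0 = 0"
      "\<And>t. \<bar>t\<bar> \<le> B \<Longrightarrow> \<bar>p t - g' t\<bar> \<le> inverse (real (Suc k))"
      "\<And>t. \<bar>t\<bar> \<le> B \<Longrightarrow> \<bar>P t - g t\<bar> \<le> inverse (real (Suc k)) * \<bar>t\<bar>"
      using polynomial_C1_approximation[OF g, of "inverse (real (Suc k))" B] by auto
    with B show ?thesis by blast
  qed
  then obtain P p where P: "\<And>k. real_polynomial_function (P k)" "\<And>k t. (P k has_real_derivative p k t) (at t)"
    "\<And>k. P k 0 = 0"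
    and pb: "\<And>k x. \<bar>p k (\<phi> k x) - g' (\<phi> k x)\<bar> \<le> inverse (real (Suc k))"
    and Pb: "\<And>k x. \<bar>P k (\<phi> k x) - g (\<phi> k x)\<bar> \<le> inverse (real (Suc k)) * \<bar>\<phi> k x\<bar>"
    by metis
  have M0: "0 \<le> M" using M[of 0] by linarith
  have lip: "\<bar>g s - g t\<bar> \<le> M * \<bar>s - t\<bar>" for s t
    using field_differentiable_bound[of UNIV g g' M s t] g(1) M by auto
  have gc: "continuous_on UNIV g"
    using g(1) by (intro DERIV_continuous_on) auto
  note uL = H10_L2(1)[OF u] and DL = H10_L2(2)[OF u]
  note [measurable] = L2_measurable[OF uL] L2_measurable[OF DL]
  have [measurable]: "g \<in> borel_measurable borel" "g' \<in> borel_measurable borel"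
    using gc g(2) by (auto intro: borel_measurable_continuous_onI)
  have [measurable]: "\<phi> k \<in> borel_measurable (lebesgue_on \<Omega>)" for k
    by (rule L2_measurable[OF test_L2(1)[OF assms(1,2) \<phi>]])
  have test: "(\<lambda>x. P k (\<phi> k x)) \<in> test_functions \<Omega>" for k
    by (rule test_polynomial[OF \<phi> P(1,3)])
  have grad: "gradient (\<lambda>x. P k (\<phi> k x)) x = p k (\<phi> k x) *\<^sub>R gradient (\<phi> k) x" for k x
    by (intro gradient_compose P test_differentiable[OF \<phi>])
  have guL: "(\<lambda>x. g (u x)) \<in> L2 \<Omega>"
  proof (rule L2_mono[OF L2_scaleR[OF uL, of M]])
    show "AE x in lebesgue_on \<Omega>. norm (g (u x)) \<le> norm (M *\<^sub>R u x)"
      using lip[of _ 0] M0 g(3) by (auto simp: abs_mult)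
  qed measurable
  have gDL: "(\<lambda>x. g' (u x) *\<^sub>R Du x) \<in> L2 \<Omega>"
  proof (rule L2_mono[OF L2_scaleR[OF DL, of M]])
    show "AE x in lebesgue_on \<Omega>. norm (g' (u x) *\<^sub>R Du x) \<le> norm (M *\<^sub>R Du x)"
      using M M0 by (auto intro!: mult_right_mono)
  qed measurable
  have small: "(\<lambda>k. inverse (real (Suc k))) \<longlonglongrightarrow> 0" by (rule LIMSEQ_inverse_real_of_nat)
  have inv1: "inverse (real (Suc k)) \<le> 1" for k by (simp add: field_simps)
  show ?thesis
  proof (rule H10I[OF assms(1,2) guL gDL test])
    have "L2_null \<Omega> (\<lambda>k x. inverse (real (Suc k)) *\<^sub>R norm (u x) + (M + 1) *\<^sub>R norm (\<phi> k x - u x))"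
      by (intro L2_null_add L2_null_scaleR_left[OF small] L2_norm uL L2_null_scaleR L2_null_norm nu)
    then show "L2_null \<Omega> (\<lambda>k x. P k (\<phi> k x) - g (u x))"
    proof (rule L2_null_mono)
      show "(\<lambda>x. P k (\<phi> k x) - g (u x)) \<in> borel_measurable (lebesgue_on \<Omega>)" for k
        using L2_measurable[OF test_L2(1)[OF assms(1,2) test]] by measurable
      have bound: "\<bar>P k (\<phi> k x) - g (u x)\<bar> \<le> inverse (real (Suc k)) * \<bar>u x\<bar> + (M + 1) * \<bar>\<phi> k x - u x\<bar>" for k x
      proof -
        have "inverse (real (Suc k)) * \<bar>\<phi> k x\<bar> \<le> inverse (real (Suc k)) * (\<bar>u x\<bar> + \<bar>\<phi> k x - u x\<bar>)"
          by (intro mult_left_mono) auto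
        moreover have "inverse (real (Suc k)) * \<bar>\<phi> k x - u x\<bar> \<le> 1 * \<bar>\<phi> k x - u x\<bar>"
          by (intro mult_right_mono inv1) auto
        ultimately show ?thesis
          using Pb[of k x] lip[of "\<phi> k x" "u x"] unfolding distrib_left distrib_right by linarith
      qed
      show "AE x in lebesgue_on \<Omega>. norm (P k (\<phi> k x) - g (u x))
          \<le> norm (inverse (real (Suc k)) *\<^sub>R norm (u x) + (M + 1) *\<^sub>R norm (\<phi> k x - u x))" for k
        unfolding real_norm_def real_scaleR_def by (intro AE_I2 order_trans[OF bound abs_ge_self])
    qed
    have dom: "L2_null \<Omega> (\<lambda>k x. (g' (\<phi> k x) - g' (u x)) *\<^sub>R Du x)"
    proof (rule L2_null_dominated[OF L2_scaleR[OF DL, of "2 * M"]])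
      show "AE x in lebesgue_on \<Omega>. norm ((g' (\<phi> k x) - g' (u x)) *\<^sub>R Du x) \<le> norm ((2 * M) *\<^sub>R Du x)" for k
      proof (rule AE_I2)
        fix x
        have "\<bar>g' (\<phi> k x) - g' (u x)\<bar> \<le> 2 * M" using M[of "\<phi> k x"] M[of "u x"] by linarith
        then show "norm ((g' (\<phi> k x) - g' (u x)) *\<^sub>R Du x) \<le> norm ((2 * M) *\<^sub>R Du x)"
          using M0 by (auto intro!: mult_right_mono)
      qed
      show "AE x in lebesgue_on \<Omega>. (\<lambda>k. (g' (\<phi> k x) - g' (u x)) *\<^sub>R Du x) \<longlonglongrightarrow> 0"
        using r(2)
      proof eventually_elim
        case (elim x)
        then have "(\<lambda>k. \<phi> k x) \<longlonglongrightarrow> u x" by (simp add: \<phi>_def LIM_zero_iff)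
        moreover have "isCont g' (u x)" using g(2) by (simp add: continuous_on_eq_continuous_at)
        ultimately have "(\<lambda>k. g' (\<phi> k x)) \<longlonglongrightarrow> g' (u x)" by (rule isCont_tendsto_compose[rotated])
        then have "(\<lambda>k. g' (\<phi> k x) - g' (u x)) \<longlonglongrightarrow> 0" by (rule LIM_zero)
        from tendsto_scaleR[OF this tendsto_const, of "Du x"] show ?case by simp
      qed
    qed measurable
    have "L2_null \<Omega> (\<lambda>k x. (inverse (real (Suc k)) *\<^sub>R norm (Du x) + (M + 1) *\<^sub>R norm (gradient (\<phi> k) x - Du x))
        + norm ((g' (\<phi> k x) - g' (u x)) *\<^sub>R Du x))"
      by (intro L2_null_add L2_null_scaleR_left[OF small] L2_norm DL L2_null_scaleR L2_null_norm[OF nD]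
          L2_null_norm[OF dom])
    then show "L2_null \<Omega> (\<lambda>k x. gradient (\<lambda>x. P k (\<phi> k x)) x - g' (u x) *\<^sub>R Du x)"
    proof (rule L2_null_mono)
      show "(\<lambda>x. gradient (\<lambda>x. P k (\<phi> k x)) x - g' (u x) *\<^sub>R Du x) \<in> borel_measurable (lebesgue_on \<Omega>)" for k
        using L2_measurable[OF test_L2(2)[OF assms(1,2) test]] by measurable
      have bound: "norm (gradient (\<lambda>x. P k (\<phi> k x)) x - g' (u x) *\<^sub>R Du x) \<le>
          (inverse (real (Suc k)) * norm (Du x) + (M + 1) * norm (gradient (\<phi> k) x - Du x))
          + norm ((g' (\<phi> k x) - g' (u x)) *\<^sub>R Du x)" for k x
      proof -
        let ?i = "inverse (real (Suc k))"
        have pM: "\<bar>p k (\<phi> k x)\<bar> \<le> M + 1"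
          using pb[of k x] M[of "\<phi> k x"] inv1[of k] by linarith
        \<comment> \<open>The three error sources: the polynomial, the gradient of \<open>\<phi> k\<close>, and the argument of \<open>g'\<close>.\<close>
        have "gradient (\<lambda>x. P k (\<phi> k x)) x - g' (u x) *\<^sub>R Du x
          = (p k (\<phi> k x) - g' (\<phi> k x)) *\<^sub>R Du x + p k (\<phi> k x) *\<^sub>R (gradient (\<phi> k) x - Du x)
            + (g' (\<phi> k x) - g' (u x)) *\<^sub>R Du x"
          by (simp add: grad algebra_simps)
        also have "norm \<dots> \<le> norm ((p k (\<phi> k x) - g' (\<phi> k x)) *\<^sub>R Du x)
            + norm (p k (\<phi> k x) *\<^sub>R (gradient (\<phi> k) x - Du x))
            + norm ((g' (\<phi> k x) - g' (u x)) *\<^sub>R Du x)"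
          by (intro norm_triangle_le add_right_mono norm_triangle_ineq)
        also have "norm ((p k (\<phi> k x) - g' (\<phi> k x)) *\<^sub>R Du x) \<le> ?i * norm (Du x)"
          using pb[of k x] by (auto intro!: mult_right_mono)
        also have "norm (p k (\<phi> k x) *\<^sub>R (gradient (\<phi> k) x - Du x)) \<le> (M + 1) * norm (gradient (\<phi> k) x - Du x)"
          using pM by (auto intro!: mult_right_mono)
        finally show ?thesis by simp
      qed
      show "AE x in lebesgue_on \<Omega>. norm (gradient (\<lambda>x. P k (\<phi> k x)) x - g' (u x) *\<^sub>R Du x)
          \<le> norm ((inverse (real (Suc k)) *\<^sub>R norm (Du x) + (M + 1) *\<^sub>R norm (gradient (\<phi> k) x - Du x))
          + norm ((g' (\<phi> k x) - g' (u x)) *\<^sub>R Du x))" for k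
        unfolding real_norm_def real_scaleR_def by (intro AE_I2 order_trans[OF bound abs_ge_self])
    qed
  qed
qed

section \<open>The weak equation and the stability inequality\<close>

lemma component_measurable:
  fixes v :: "'a \<Rightarrow> real^'n::finite"
  assumes "v \<in> borel_measurable M" shows "(\<lambda>x. v x $ i) \<in> borel_measurable M"
  unfolding cart_eq_inner_axis using assms by measurable

lemma matrix_vector_measurable:
  fixes A :: "'a \<Rightarrow> real^'n::finite^'n" and v :: "'a \<Rightarrow> real^'n"
  assumes "\<And>i j. (\<lambda>x. A x $ i $ j) \<in> borel_measurable M" "v \<in> borel_measurable M"
  shows "(\<lambda>x. A x *v v x) \<in> borel_measurable M"
proof (subst borel_measurable_euclidean_space, rule ballI)
  fix b :: "real^'n" assume "b \<in> Basis"
  then obtain i where b: "b = axis i 1" by (auto simp: Basis_vec_def)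
  have "(\<lambda>x. \<Sum>j\<in>UNIV. A x $ i $ j * v x $ j) \<in> borel_measurable M"
    using assms component_measurable[OF assms(2)] by (intro borel_measurable_sum borel_measurable_times)
  then show "(\<lambda>x. (A x *v v x) \<bullet> b) \<in> borel_measurable M"
    by (simp add: b inner_axis matrix_vector_mult_def)
qed

text \<open>
  The ellipticity condition bounds only the quadratic form; the bound on the vector \<open>a y\<close> is taken from
  the essential boundedness of the coefficients.
\<close>

lemma uniformly_elliptic_bound:
  assumes "uniformly_elliptic \<Omega> a"
  obtains K where "0 \<le> K" "AE x in lebesgue_on \<Omega>. \<forall>y. norm (a x *v y) \<le> K * norm y"
proof -
  have "\<forall>i j. \<exists>M. AE x in lebesgue_on \<Omega>. \<bar>a x $ i $ j\<bar> \<le> M"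
    using assms by (auto simp: uniformly_elliptic_def)
  then obtain M where M: "\<And>i j. AE x in lebesgue_on \<Omega>. \<bar>a x $ i $ j\<bar> \<le> M i j" by metis
  define K where "K = (\<Sum>i\<in>UNIV. \<Sum>j\<in>UNIV. \<bar>M i j\<bar>)"
  have "AE x in lebesgue_on \<Omega>. \<forall>i j. \<bar>a x $ i $ j\<bar> \<le> M i j"
    using M by (intro eventually_all_finite)
  then have "AE x in lebesgue_on \<Omega>. \<forall>y. norm (a x *v y) \<le> K * norm y"
  proof eventually_elim
    case (elim x)
    show ?case
    proof
      fix y
      have "norm (a x *v y) \<le> (\<Sum>i\<in>UNIV. \<bar>\<Sum>j\<in>UNIV. a x $ i $ j * y $ j\<bar>)"
        using norm_le_l1_cart[of "a x *v y"] by (simp add: matrix_vector_mult_def)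
      also have "\<dots> \<le> (\<Sum>i\<in>UNIV. \<Sum>j\<in>UNIV. \<bar>M i j\<bar> * norm y)"
      proof (intro sum_mono order_trans[OF sum_abs])
        fix i j
        have "\<bar>a x $ i $ j\<bar> \<le> \<bar>M i j\<bar>" using elim by (meson abs_ge_self order_trans)
        then show "\<bar>a x $ i $ j * y $ j\<bar> \<le> \<bar>M i j\<bar> * norm y"
          unfolding abs_mult by (intro mult_mono component_le_norm_cart) auto
      qed
      also have "\<dots> = K * norm y" by (simp add: K_def sum_distrib_right)
      finally show "norm (a x *v y) \<le> K * norm y" .
    qed
  qed
  then show ?thesis by (rule that[rotated]) (simp add: K_def sum_nonneg)
qed

lemma elliptic_L2:
  assumes "uniformly_elliptic \<Omega> a" "v \<in> L2 \<Omega>"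
  shows "(\<lambda>x. a x *v v x) \<in> L2 \<Omega>"
proof -
  obtain K where K: "0 \<le> K" "AE x in lebesgue_on \<Omega>. \<forall>y. norm (a x *v y) \<le> K * norm y"
    by (rule uniformly_elliptic_bound[OF assms(1)])
  show ?thesis
  proof (rule L2_mono[OF L2_scaleR[OF assms(2), of K]])
    show "(\<lambda>x. a x *v v x) \<in> borel_measurable (lebesgue_on \<Omega>)"
      using assms by (intro matrix_vector_measurable) (auto simp: uniformly_elliptic_def L2_measurable)
    show "AE x in lebesgue_on \<Omega>. norm (a x *v v x) \<le> norm (K *\<^sub>R v x)"
      using K(2) by eventually_elim (use K(1) in auto)
  qed
qed

lemma elliptic_L2_null:
  assumes "uniformly_elliptic \<Omega> a" "L2_null \<Omega> w"
  shows "(\<lambda>k. LINT x|lebesgue_on \<Omega>. w k x \<bullet> (a x *v w k x)) \<longlonglongrightarrow> 0"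
proof -
  obtain K where K: "0 \<le> K" "AE x in lebesgue_on \<Omega>. \<forall>y. norm (a x *v y) \<le> K * norm y"
    by (rule uniformly_elliptic_bound[OF assms(1)])
  note w = L2_null_L2[OF assms(2)]
  show ?thesis
  proof (rule Lim_null_comparison)
    show "(\<lambda>k. K * (LINT x|lebesgue_on \<Omega>. (norm (w k x))\<^sup>2)) \<longlonglongrightarrow> 0"
      using tendsto_mult[OF tendsto_const L2_null_lim[OF assms(2)], of K] by simp
    have "norm (LINT x|lebesgue_on \<Omega>. w k x \<bullet> (a x *v w k x)) \<le> K * (LINT x|lebesgue_on \<Omega>. (norm (w k x))\<^sup>2)" for k
    proof -
      have "norm (LINT x|lebesgue_on \<Omega>. w k x \<bullet> (a x *v w k x))
          \<le> (LINT x|lebesgue_on \<Omega>. norm (w k x \<bullet> (a x *v w k x)))"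
        by (rule integral_norm_bound)
      also have "\<dots> \<le> (LINT x|lebesgue_on \<Omega>. K * (norm (w k x))\<^sup>2)"
      proof (rule integral_mono_AE)
        show "integrable (lebesgue_on \<Omega>) (\<lambda>x. norm (w k x \<bullet> (a x *v w k x)))"
          by (intro integrable_norm L2_integrable_inner w elliptic_L2[OF assms(1)])
        show "integrable (lebesgue_on \<Omega>) (\<lambda>x. K * (norm (w k x))\<^sup>2)"
          by (intro integrable_mult_right L2_integrable w)
        show "AE x in lebesgue_on \<Omega>. norm (w k x \<bullet> (a x *v w k x)) \<le> K * (norm (w k x))\<^sup>2"
          using K(2)
        proof eventually_elim
          case (elim x)
          have "norm (w k x \<bullet> (a x *v w k x)) \<le> norm (w k x) * norm (a x *v w k x)"
            by (simp add: Cauchy_Schwarz_ineq2)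
          also have "\<dots> \<le> norm (w k x) * (K * norm (w k x))"
            using elim by (intro mult_left_mono) auto
          finally show ?case by (simp add: power2_eq_square mult_ac)
        qed
      qed
      finally show ?thesis by simp
    qed
    then show "\<forall>\<^sub>F k in sequentially. norm (LINT x|lebesgue_on \<Omega>. w k x \<bullet> (a x *v w k x))
        \<le> K * (LINT x|lebesgue_on \<Omega>. (norm (w k x))\<^sup>2)" by simp
  qed
qed

text \<open>
  Here \<open>F\<close> and \<open>W\<close> stand for \<open>f(u)\<close> and \<open>f'(u)\<close>. Besides the signs of \<open>f\<close> and \<open>f'\<close>, the nonlinearity
  enters through the bound \<open>F \<le> c + W \<bar>u\<bar>\<close>, which convexity provides.
\<close>

locale semistable_equation =
  fixes \<Omega> :: "(real^'n::finite) set" and a :: "real^'n \<Rightarrow> real^'n^'n"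
    and u :: "real^'n \<Rightarrow> real" and Du :: "real^'n \<Rightarrow> real^'n"
    and F W :: "real^'n \<Rightarrow> real" and c :: real
  assumes domain: "open \<Omega>" "bounded \<Omega>"
    and elliptic: "uniformly_elliptic \<Omega> a"
    and u_H10: "(u, Du) \<in> H10 \<Omega>"
    and F_measurable: "F \<in> borel_measurable (lebesgue_on \<Omega>)"
    and W_measurable: "W \<in> borel_measurable (lebesgue_on \<Omega>)"
    and F_nonneg: "\<And>x. 0 \<le> F x" and W_nonneg: "\<And>x. 0 \<le> W x" and c_nonneg: "0 \<le> c"
    and F_le: "\<And>x. F x \<le> c + W x * \<bar>u x\<bar>"
    and equation: "\<And>\<phi>. \<phi> \<in> test_functions \<Omega> \<Longrightarrow>
      (LINT x|lebesgue_on \<Omega>. gradient \<phi> x \<bullet> (a x *v Du x)) = (LINT x|lebesgue_on \<Omega>. F x * \<phi> x)"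
    and stable_integrable: "\<And>\<eta> D\<eta>. (\<eta>, D\<eta>) \<in> H10 \<Omega> \<Longrightarrow> integrable (lebesgue_on \<Omega>) (\<lambda>x. W x * (\<eta> x)\<^sup>2)"
    and stable: "\<And>\<eta> D\<eta>. (\<eta>, D\<eta>) \<in> H10 \<Omega> \<Longrightarrow>
      (LINT x|lebesgue_on \<Omega>. W x * (\<eta> x)\<^sup>2) \<le> (LINT x|lebesgue_on \<Omega>. D\<eta> x \<bullet> (a x *v D\<eta> x))"
begin

lemma weighted_L2:
  assumes "(\<eta>, D\<eta>) \<in> H10 \<Omega>" shows "(\<lambda>x. sqrt (W x) * \<eta> x) \<in> L2 \<Omega>"
proof -
  note [measurable] = W_measurable L2_measurable[OF H10_L2(1)[OF assms]]
  show ?thesis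
    using stable_integrable[OF assms] W_nonneg by (simp add: L2_def power_mult_distrib)
qed

text \<open>
  The weight is split evenly, \<open>W \<bar>u\<bar> \<bar>t\<bar> = (\<surd>W \<bar>u\<bar>) (\<surd>W \<bar>t\<bar>)\<close>: for \<open>t = \<eta> x\<close> stability bounds both factors
  in \<open>L2\<close>.
\<close>

lemma source_bound:
  "\<bar>F x * t\<bar> \<le> norm c * norm t + norm (sqrt (W x) * u x) * norm (sqrt (W x) * t)"
proof -
  have "\<bar>F x * t\<bar> \<le> (c + W x * \<bar>u x\<bar>) * \<bar>t\<bar>"
    unfolding abs_mult using F_nonneg F_le by (intro mult_right_mono) auto
  also have "\<dots> = c * \<bar>t\<bar> + (sqrt (W x) * sqrt (W x)) * \<bar>u x\<bar> * \<bar>t\<bar>"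
    using W_nonneg[of x] by (simp add: algebra_simps)
  also have "\<dots> = norm c * norm t + norm (sqrt (W x) * u x) * norm (sqrt (W x) * t)"
    using c_nonneg W_nonneg[of x] by (simp only: real_norm_def abs_mult) (simp add: algebra_simps)
  finally show ?thesis .
qed

lemma const_L2: "(\<lambda>x. c) \<in> L2 \<Omega>"
  by (rule L2_bounded[OF finite_measure_domain[OF domain], of _ "\<bar>c\<bar>"]) auto

lemma source_integrable:
  assumes "(\<eta>, D\<eta>) \<in> H10 \<Omega>" shows "integrable (lebesgue_on \<Omega>) (\<lambda>x. F x * \<eta> x)"
proof (rule Bochner_Integration.integrable_bound)
  note \<eta> = H10_L2(1)[OF assms]
  note [measurable] = F_measurable L2_measurable[OF \<eta>]
  show "integrable (lebesgue_on \<Omega>)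
     (\<lambda>x. norm c * norm (\<eta> x) + norm (sqrt (W x) * u x) * norm (sqrt (W x) * \<eta> x))"
    by (intro Bochner_Integration.integrable_add L2_integrable_mult const_L2 \<eta> weighted_L2[OF u_H10] weighted_L2[OF assms])
  show "(\<lambda>x. F x * \<eta> x) \<in> borel_measurable (lebesgue_on \<Omega>)" by measurable
  show "AE x in lebesgue_on \<Omega>. norm (F x * \<eta> x)
      \<le> norm (norm c * norm (\<eta> x) + norm (sqrt (W x) * u x) * norm (sqrt (W x) * \<eta> x))"
    using order_trans[OF source_bound abs_ge_self] by (intro AE_I2) (simp only: real_norm_def)
qed

text \<open>
  Let test functions \<open>\<psi> k\<close> converge to \<open>v\<close>. The left-hand side converges by boundedness of the coefficients.
  For the right-hand side, stability applied to \<open>\<psi> k - v\<close> shows that \<open>\<surd>W (\<psi> k - v)\<close> tends to zero in \<open>L2\<close>, and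
  \<open>source_bound\<close> does the rest.
\<close>

lemma equation_H10:
  assumes v: "(v, Dv) \<in> H10 \<Omega>"
  shows "(LINT x|lebesgue_on \<Omega>. Dv x \<bullet> (a x *v Du x)) = (LINT x|lebesgue_on \<Omega>. F x * v x)"
proof -
  obtain \<psi> where \<psi>: "\<And>k. \<psi> k \<in> test_functions \<Omega>"
    "L2_null \<Omega> (\<lambda>k x. \<psi> k x - v x)" "L2_null \<Omega> (\<lambda>k x. gradient (\<psi> k) x - Dv x)"
    using H10E[OF domain v] by blast
  note aDu = elliptic_L2[OF elliptic H10_L2(2)[OF u_H10]]
  have "(\<lambda>k. LINT x|lebesgue_on \<Omega>. (a x *v Du x) \<bullet> (gradient (\<psi> k) x - Dv x)) \<longlonglongrightarrow> 0"
    by (rule L2_null_inner[OF aDu \<psi>(3)])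
  moreover have "(LINT x|lebesgue_on \<Omega>. (a x *v Du x) \<bullet> (gradient (\<psi> k) x - Dv x))
      = (LINT x|lebesgue_on \<Omega>. F x * \<psi> k x) - (LINT x|lebesgue_on \<Omega>. Dv x \<bullet> (a x *v Du x))" for k
    using L2_integrable_inner[OF test_L2(2)[OF domain \<psi>(1)] aDu, of k]
      L2_integrable_inner[OF H10_L2(2)[OF v] aDu] equation[OF \<psi>(1), of k]
    by (simp add: inner_diff_right inner_commute)
  ultimately have lim1: "(\<lambda>k. LINT x|lebesgue_on \<Omega>. F x * \<psi> k x) \<longlonglongrightarrow>
      (LINT x|lebesgue_on \<Omega>. Dv x \<bullet> (a x *v Du x))"
    by (simp add: LIM_zero_iff)
  have diff: "(\<lambda>x. \<psi> k x - v x, \<lambda>x. gradient (\<psi> k) x - Dv x) \<in> H10 \<Omega>" for k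
    by (rule H10_test_diff[OF domain v \<psi>(1)])
  have weighted: "L2_null \<Omega> (\<lambda>k x. sqrt (W x) * (\<psi> k x - v x))"
    unfolding L2_null_def
  proof
    show "\<forall>k. (\<lambda>x. sqrt (W x) * (\<psi> k x - v x)) \<in> L2 \<Omega>" using weighted_L2[OF diff] by blast
    have "(\<lambda>k. LINT x|lebesgue_on \<Omega>. W x * (\<psi> k x - v x)\<^sup>2) \<longlonglongrightarrow> 0"
    proof (rule tendsto_sandwich[OF _ _ tendsto_const elliptic_L2_null[OF elliptic \<psi>(3)]])
      show "\<forall>\<^sub>F k in sequentially. 0 \<le> (LINT x|lebesgue_on \<Omega>. W x * (\<psi> k x - v x)\<^sup>2)"
        using W_nonneg by simp
    qed (use stable[OF diff] in simp)
    then show "(\<lambda>k. LINT x|lebesgue_on \<Omega>. (norm (sqrt (W x) * (\<psi> k x - v x)))\<^sup>2) \<longlonglongrightarrow> 0"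
      using W_nonneg by (simp add: power_mult_distrib)
  qed
  have "(\<lambda>k. (LINT x|lebesgue_on \<Omega>. F x * (\<psi> k x - v x))) \<longlonglongrightarrow> 0"
  proof (rule Lim_null_comparison)
    show "(\<lambda>k. (LINT x|lebesgue_on \<Omega>. norm c * norm (\<psi> k x - v x))
        + (LINT x|lebesgue_on \<Omega>. norm (sqrt (W x) * u x) * norm (sqrt (W x) * (\<psi> k x - v x)))) \<longlonglongrightarrow> 0"
      using tendsto_add[OF L2_null_pairing[OF const_L2 \<psi>(2)]
          L2_null_pairing[OF weighted_L2[OF u_H10] weighted]] by simp
    have "norm (LINT x|lebesgue_on \<Omega>. F x * (\<psi> k x - v x)) \<le> (LINT x|lebesgue_on \<Omega>. norm c * norm (\<psi> k x - v x))
        + (LINT x|lebesgue_on \<Omega>. norm (sqrt (W x) * u x) * norm (sqrt (W x) * (\<psi> k x - v x)))" for k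
    proof -
      note i = L2_integrable_mult[OF const_L2 L2_null_L2[OF \<psi>(2), of k]]
        L2_integrable_mult[OF weighted_L2[OF u_H10] L2_null_L2[OF weighted, of k]]
      have "norm (LINT x|lebesgue_on \<Omega>. F x * (\<psi> k x - v x))
          \<le> (LINT x|lebesgue_on \<Omega>. norm (F x * (\<psi> k x - v x)))"
        by (rule integral_norm_bound)
      also have "\<dots> \<le> (LINT x|lebesgue_on \<Omega>. norm c * norm (\<psi> k x - v x)
          + norm (sqrt (W x) * u x) * norm (sqrt (W x) * (\<psi> k x - v x)))"
        by (intro integral_mono integrable_norm source_integrable[OF diff] Bochner_Integration.integrable_add i)
          (simp only: real_norm_def[of "F _ * _"] source_bound)
      also have "\<dots> = (LINT x|lebesgue_on \<Omega>. norm c * norm (\<psi> k x - v x))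
        + (LINT x|lebesgue_on \<Omega>. norm (sqrt (W x) * u x) * norm (sqrt (W x) * (\<psi> k x - v x)))"
        by (rule Bochner_Integration.integral_add[OF i])
      finally show ?thesis .
    qed
    then show "\<forall>\<^sub>F k in sequentially. norm (LINT x|lebesgue_on \<Omega>. F x * (\<psi> k x - v x))
        \<le> (LINT x|lebesgue_on \<Omega>. norm c * norm (\<psi> k x - v x))
        + (LINT x|lebesgue_on \<Omega>. norm (sqrt (W x) * u x) * norm (sqrt (W x) * (\<psi> k x - v x)))"
      by simp
  qed
  moreover have "(LINT x|lebesgue_on \<Omega>. F x * (\<psi> k x - v x))
      = (LINT x|lebesgue_on \<Omega>. F x * \<psi> k x) - (LINT x|lebesgue_on \<Omega>. F x * v x)" for k
    using source_integrable[OF test_H10[OF domain \<psi>(1)], of k] source_integrable[OF v]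
    by (simp add: right_diff_distrib)
  ultimately have lim2: "(\<lambda>k. LINT x|lebesgue_on \<Omega>. F x * \<psi> k x) \<longlonglongrightarrow> (LINT x|lebesgue_on \<Omega>. F x * v x)"
    by (simp add: LIM_zero_iff)
  from LIMSEQ_unique[OF lim1 lim2] show ?thesis .
qed

text \<open>
  The chain rule turns \<open>g'(u)\<^sup>2 Du\<close> into the gradient of \<open>G(u)\<close>, so that the energy of \<open>g(u)\<close> is the
  left-hand side of the equation tested with \<open>G(u)\<close>.
\<close>

theorem stability_test:
  fixes g g' G :: "real \<Rightarrow> real"
  assumes g: "\<And>t. (g has_real_derivative g' t) (at t)" "g 0 = 0"
    and G: "\<And>t. (G has_real_derivative (g' t)\<^sup>2) (at t)" "G 0 = 0"
    and g': "continuous_on UNIV g'" "\<And>t. \<bar>g' t\<bar> \<le> M"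
  shows "integrable (lebesgue_on \<Omega>) (\<lambda>x. W x * (g (u x))\<^sup>2 - F x * G (u x))"
    and "(LINT x|lebesgue_on \<Omega>. W x * (g (u x))\<^sup>2 - F x * G (u x)) \<le> 0"
proof -
  have gH: "(\<lambda>x. g (u x), \<lambda>x. g' (u x) *\<^sub>R Du x) \<in> H10 \<Omega>"
    by (rule H10_chain_rule[OF domain u_H10 g(1) g'(1) g(2) g'(2)])
  have "(g' t)\<^sup>2 \<le> M\<^sup>2" for t
    using power_mono[OF g'(2)[of t], of 2] by simp
  then have GH: "(\<lambda>x. G (u x), \<lambda>x. (g' (u x))\<^sup>2 *\<^sub>R Du x) \<in> H10 \<Omega>"
    by (intro H10_chain_rule[OF domain u_H10 G(1) _ G(2)] continuous_intros g'(1)) simp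
  note i = stable_integrable[OF gH] source_integrable[OF GH]
  show "integrable (lebesgue_on \<Omega>) (\<lambda>x. W x * (g (u x))\<^sup>2 - F x * G (u x))"
    by (rule Bochner_Integration.integrable_diff[OF i])
  have "(LINT x|lebesgue_on \<Omega>. W x * (g (u x))\<^sup>2)
      \<le> (LINT x|lebesgue_on \<Omega>. (g' (u x) *\<^sub>R Du x) \<bullet> (a x *v (g' (u x) *\<^sub>R Du x)))"
    by (rule stable[OF gH])
  also have "\<dots> = (LINT x|lebesgue_on \<Omega>. ((g' (u x))\<^sup>2 *\<^sub>R Du x) \<bullet> (a x *v Du x))"
    by (simp add: matrix_vector_mult_scaleR power2_eq_square mult.assoc)
  also have "\<dots> = (LINT x|lebesgue_on \<Omega>. F x * G (u x))"
    by (rule equation_H10[OF GH])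
  finally show "(LINT x|lebesgue_on \<Omega>. W x * (g (u x))\<^sup>2 - F x * G (u x)) \<le> 0"
    using i by simp
qed

end

text \<open>
  The positivity of a solution holds almost everywhere only, and \<open>f\<close> is arbitrary on the negative
  half-line. Completeness of Lebesgue measure makes \<open>f(u)\<close> measurable nevertheless, since it agrees almost
  everywhere with \<open>f(max 0 u)\<close>.
\<close>

lemma borel_measurable_lebesgue_on_AE:
  fixes h k :: "'a::euclidean_space \<Rightarrow> real"
  assumes "open \<Omega>" "h \<in> borel_measurable (lebesgue_on \<Omega>)" "AE x in lebesgue_on \<Omega>. h x = k x"
  shows "k \<in> borel_measurable (lebesgue_on \<Omega>)"
proof -
  have \<Omega>: "\<Omega> \<inter> space lebesgue \<in> sets lebesgue" using assms(1) by simp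
  have "(\<lambda>x. indicator \<Omega> x *\<^sub>R h x) \<in> borel_measurable lebesgue"
    using assms(2) by (simp only: borel_measurable_restrict_space_iff[OF \<Omega>])
  moreover have "AE x in lebesgue. indicator \<Omega> x *\<^sub>R h x = indicator \<Omega> x *\<^sub>R k x"
    using assms(3) unfolding AE_restrict_space_iff[OF \<Omega>]
    by eventually_elim (auto simp: indicator_def)
  ultimately have "(\<lambda>x. indicator \<Omega> x *\<^sub>R k x) \<in> borel_measurable lebesgue"
    by (rule borel_measurable_AE)
  then show ?thesis by (simp only: borel_measurable_restrict_space_iff[OF \<Omega>])
qed

text \<open>
  Where \<open>u\<close> fails to be positive, which happens on a null set only, \<open>f(u)\<close> is replaced by \<open>f(0)\<close>; the
  pointwise bounds of the locale then hold everywhere.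
\<close>

lemma semistable_equation_of_solution:
  assumes f: "increasing_convex f f' f'' \<beta>"
    and \<Omega>: "open \<Omega>" "bounded \<Omega>" and a: "uniformly_elliptic \<Omega> a"
    and u: "dirichlet_solution \<Omega> a f u" "AE x in lebesgue_on \<Omega>. u x > 0" "semistable \<Omega> a f' u"
  obtains Du where
    "semistable_equation \<Omega> a u Du (\<lambda>x. f (max 0 (u x))) (\<lambda>x. f' (max 0 (u x))) (f 0)"
proof -
  interpret increasing_convex f f' f'' \<beta> by (rule f)
  obtain Du where Du: "(u, Du) \<in> H10 \<Omega>"
    and eq: "\<And>\<phi>. \<phi> \<in> test_functions \<Omega> \<Longrightarrow>
      (LINT x|lebesgue_on \<Omega>. gradient \<phi> x \<bullet> (a x *v Du x)) = (LINT x|lebesgue_on \<Omega>. f (u x) * \<phi> x)"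
    using u(1) by (auto simp: dirichlet_solution_def)
  note [measurable] = L2_measurable[OF H10_L2(1)[OF Du]]
  have [measurable]: "(\<lambda>t. f (max 0 t)) \<in> borel_measurable borel" "(\<lambda>t. f' (max 0 t)) \<in> borel_measurable borel"
    by (intro borel_measurable_continuous_onI continuous_on_compose_max_0 f_cont f'_cont)+
  have F [measurable]: "(\<lambda>x. f (max 0 (u x))) \<in> borel_measurable (lebesgue_on \<Omega>)"
    by (rule measurable_compose[of u _ borel "\<lambda>t. f (max 0 t)"]) measurable
  have W [measurable]: "(\<lambda>x. f' (max 0 (u x))) \<in> borel_measurable (lebesgue_on \<Omega>)"
    by (rule measurable_compose[of u _ borel "\<lambda>t. f' (max 0 t)"]) measurable
  have Feq: "AE x in lebesgue_on \<Omega>. f (max 0 (u x)) = f (u x)"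
    using u(2) by eventually_elim simp
  have Weq: "AE x in lebesgue_on \<Omega>. f' (max 0 (u x)) = f' (u x)"
    using u(2) by eventually_elim simp
  have [measurable]: "(\<lambda>x. f (u x)) \<in> borel_measurable (lebesgue_on \<Omega>)"
    "(\<lambda>x. f' (u x)) \<in> borel_measurable (lebesgue_on \<Omega>)"
    using borel_measurable_lebesgue_on_AE[OF \<Omega>(1) F Feq] borel_measurable_lebesgue_on_AE[OF \<Omega>(1) W Weq] .
  have stable: "integrable (lebesgue_on \<Omega>) (\<lambda>x. f' (max 0 (u x)) * (\<eta> x)\<^sup>2) \<and>
      (LINT x|lebesgue_on \<Omega>. f' (max 0 (u x)) * (\<eta> x)\<^sup>2) \<le> (LINT x|lebesgue_on \<Omega>. D\<eta> x \<bullet> (a x *v D\<eta> x))"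
    if \<eta>: "(\<eta>, D\<eta>) \<in> H10 \<Omega>" for \<eta> D\<eta>
  proof -
    note [measurable] = L2_measurable[OF H10_L2(1)[OF \<eta>]]
    have ae: "AE x in lebesgue_on \<Omega>. f' (u x) * (\<eta> x)\<^sup>2 = f' (max 0 (u x)) * (\<eta> x)\<^sup>2"
      using Weq by eventually_elim simp
    have m: "(\<lambda>x. f' (u x) * (\<eta> x)\<^sup>2) \<in> borel_measurable (lebesgue_on \<Omega>)"
      "(\<lambda>x. f' (max 0 (u x)) * (\<eta> x)\<^sup>2) \<in> borel_measurable (lebesgue_on \<Omega>)" by measurable
    have "integrable (lebesgue_on \<Omega>) (\<lambda>x. f' (u x) * (\<eta> x)\<^sup>2) \<and>
      (LINT x|lebesgue_on \<Omega>. f' (u x) * (\<eta> x)\<^sup>2) \<le> (LINT x|lebesgue_on \<Omega>. D\<eta> x \<bullet> (a x *v D\<eta> x))"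
      using u(3) \<eta> by (auto simp: semistable_def)
    then show ?thesis
      using integrable_cong_AE[OF m ae] integral_cong_AE[OF m ae] by simp
  qed
  show ?thesis
  proof (rule that, unfold_locales)
    show "f (max 0 (u x)) \<le> f 0 + f' (max 0 (u x)) * \<bar>u x\<bar>" for x
    proof -
      have "max 0 (u x) * f' (max 0 (u x)) \<le> \<bar>u x\<bar> * f' (max 0 (u x))"
        by (intro mult_right_mono f'_nonneg) auto
      then show ?thesis using f_le_tangent_at_endpoint[of "max 0 (u x)"] by (simp add: mult.commute)
    qed
    show "(LINT x|lebesgue_on \<Omega>. gradient \<phi> x \<bullet> (a x *v Du x))
        = (LINT x|lebesgue_on \<Omega>. f (max 0 (u x)) * \<phi> x)" if \<phi>: "\<phi> \<in> test_functions \<Omega>" for \<phi>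
    proof -
      note [measurable] = L2_measurable[OF test_L2(1)[OF \<Omega> \<phi>]]
      have "(LINT x|lebesgue_on \<Omega>. f (u x) * \<phi> x) = (LINT x|lebesgue_on \<Omega>. f (max 0 (u x)) * \<phi> x)"
      proof (rule integral_cong_AE)
        show "AE x in lebesgue_on \<Omega>. f (u x) * \<phi> x = f (max 0 (u x)) * \<phi> x"
          using Feq by eventually_elim simp
      qed measurable
      then show ?thesis using eq[OF \<phi>] by simp
    qed
    show "0 \<le> f (max 0 (u x))" "0 \<le> f' (max 0 (u x))" for x
      using f_pos[of "max 0 (u x)"] f'_nonneg[of "max 0 (u x)"] by auto
    show "0 \<le> f 0" using f_0 by simp
    show "integrable (lebesgue_on \<Omega>) (\<lambda>x. f' (max 0 (u x)) * (\<eta> x)\<^sup>2)"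
      if "(\<eta>, D\<eta>) \<in> H10 \<Omega>" for \<eta> D\<eta> using stable[OF that] ..
    show "(LINT x|lebesgue_on \<Omega>. f' (max 0 (u x)) * (\<eta> x)\<^sup>2) \<le> (LINT x|lebesgue_on \<Omega>. D\<eta> x \<bullet> (a x *v D\<eta> x))"
      if "(\<eta>, D\<eta>) \<in> H10 \<Omega>" for \<eta> D\<eta> using stable[OF that] ..
  qed (fact \<Omega> a Du F W)+
qed

section \<open>The integral bound\<close>

text \<open>
  Fatou's lemma, applied to the nonnegative functions \<open>q k + C\<close>.
\<close>

lemma integral_bound_of_eventual_minorant:
  fixes h :: "'a \<Rightarrow> real" and q :: "nat \<Rightarrow> 'a \<Rightarrow> real"
  assumes "finite_measure M" "h \<in> borel_measurable M" "\<And>x. 0 \<le> h x"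
    and q: "\<And>k. integrable M (q k)" "\<And>k. integral\<^sup>L M (q k) \<le> 0"
    and lower: "\<And>k. AE x in M. - C \<le> q k x"
    and minorant: "AE x in M. \<forall>\<^sub>F k in sequentially. h x - C \<le> q k x"
  shows "integrable M h" "integral\<^sup>L M h \<le> C * measure M (space M)"
proof -
  interpret finite_measure M by fact
  note [measurable] = assms(2) borel_measurable_integrable[OF q(1)]
  let ?A = "C * measure M (space M)"
  have int: "integral\<^sup>L M (\<lambda>x. q k x + C) \<le> ?A" "0 \<le> integral\<^sup>L M (\<lambda>x. q k x + C)" for k
  proof -
    have "integral\<^sup>L M (\<lambda>x. q k x + C) = integral\<^sup>L M (q k) + ?A"
      using q(1) by (simp add: mult.commute)
    then show "integral\<^sup>L M (\<lambda>x. q k x + C) \<le> ?A" using q(2)[of k] by simp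
    show "0 \<le> integral\<^sup>L M (\<lambda>x. q k x + C)"
      using lower[of k] by (intro integral_nonneg_AE) (auto elim: eventually_mono)
  qed
  have A: "0 \<le> ?A" using int[of 0] by linarith
  have "(\<integral>\<^sup>+x. ennreal (h x) \<partial>M) \<le> (\<integral>\<^sup>+x. liminf (\<lambda>k. ennreal (q k x + C)) \<partial>M)"
  proof (rule nn_integral_mono_AE)
    show "AE x in M. ennreal (h x) \<le> liminf (\<lambda>k. ennreal (q k x + C))"
      using minorant
    proof eventually_elim
      case (elim x)
      then show ?case
        by (intro Liminf_bounded) (auto elim!: eventually_mono intro!: ennreal_leI)
    qed
  qed
  also have "\<dots> \<le> liminf (\<lambda>k. \<integral>\<^sup>+x. ennreal (q k x + C) \<partial>M)"
    by (rule nn_integral_liminf) measurable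
  also have "\<dots> \<le> liminf (\<lambda>k::nat. ennreal ?A)"
  proof (intro Liminf_mono always_eventually allI)
    fix k
    have "(\<integral>\<^sup>+x. ennreal (q k x + C) \<partial>M) = ennreal (integral\<^sup>L M (\<lambda>x. q k x + C))"
      using q(1) lower[of k] by (intro nn_integral_eq_integral) (auto elim: eventually_mono)
    then show "(\<integral>\<^sup>+x. ennreal (q k x + C) \<partial>M) \<le> ennreal ?A"
      using int(1)[of k] by (simp add: ennreal_leI)
  qed
  also have "\<dots> = ennreal ?A" by (simp add: Liminf_const)
  finally have le: "(\<integral>\<^sup>+x. ennreal (h x) \<partial>M) \<le> ennreal ?A" .
  then have "(\<integral>\<^sup>+x. ennreal (h x) \<partial>M) < \<infinity>" by (rule order_le_less_trans) simp
  then show h: "integrable M h"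
    using assms(3) by (intro integrableI_nonneg) auto
  have "(\<integral>\<^sup>+x. ennreal (h x) \<partial>M) = ennreal (integral\<^sup>L M h)"
    using h assms(3) by (intro nn_integral_eq_integral) auto
  then show "integral\<^sup>L M h \<le> ?A" using le A by simp
qed

theorem theorem1p1:
  fixes \<Omega> :: "(real^'n::finite) set"
    and a :: "real^'n \<Rightarrow> real^'n^'n"
    and f f' f'' :: "real \<Rightarrow> real"
    and \<beta> :: real
  assumes "CARD('n) \<ge> 2"
    and "smooth_bounded_domain \<Omega>"
    and "uniformly_elliptic \<Omega> a"
    and "C2_half_line f f' f''"
    and "convex_on {0..} f"
    and "f 0 > 0"
    and "\<forall>t\<ge>0. f' t \<ge> 0"
    and "filterlim (\<lambda>s. f s / s) at_top at_top"
    and "0 \<le> \<beta>" and "\<beta> < 1"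
  shows "\<exists>C. \<forall>u. dirichlet_solution \<Omega> a f u \<and> (AE x in lebesgue_on \<Omega>. u x > 0) \<and>
                 semistable \<Omega> a f' u \<longrightarrow>
           integrable (lebesgue_on \<Omega>) (\<lambda>x. H_fun f f'' \<beta> (u x)) \<and>
           (LINT x|lebesgue_on \<Omega>. \<bar>H_fun f f'' \<beta> (u x)\<bar>) \<le> C"
proof -
  interpret superlinear f f' f'' \<beta>
    using assms convex_second_derivative_nonneg[OF assms(4,5)] by unfold_locales auto
  have \<Omega>: "open \<Omega>" "bounded \<Omega>" using assms(2) by (auto simp: smooth_bounded_domain_def)
  note fin = finite_measure_domain[OF \<Omega>]
  obtain c C K g g' G where c: "0 < c"
    and g: "\<And>k t. 0 \<le> t \<Longrightarrow> (g k has_real_derivative g' k t) (at t within {0..})"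
    and G: "\<And>k t. 0 \<le> t \<Longrightarrow> (G k has_real_derivative (g' k t)\<^sup>2) (at t within {0..})"
    and g': "\<And>k. continuous_on {0..} (g' k)" "\<And>k. bounded (g' k ` {0..})"
    and zero: "\<And>k. g k 0 = 0" "\<And>k. G k 0 = 0"
    and lower: "\<And>k t. K \<le> k \<Longrightarrow> 0 \<le> t \<Longrightarrow> - C \<le> f' t * (g k t)\<^sup>2 - f t * G k t"
    and minorant: "\<And>k t. K \<le> k \<Longrightarrow> 0 \<le> t \<Longrightarrow> t \<le> real k \<Longrightarrow>
      c * H_fun f f'' \<beta> t - C \<le> f' t * (g k t)\<^sup>2 - f t * G k t"
    by (rule truncated_trial_functions) blast
  \<comment> \<open>For \<open>t \<le> 0\<close> both sides vanish, because \<open>H_fun\<close> integrates over \<open>{0..t}\<close>.\<close>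
  have H_max: "H_fun f f'' \<beta> t = f (max 0 t) * gain (max 0 t)" for t
    using H_fun_eq_gain[of t] gain_0 by (cases "0 \<le> t") (auto simp: H_fun_def max_def)
  have H_nonneg: "0 \<le> H_fun f f'' \<beta> t" for t
    using f_pos[of "max 0 t"] gain_nonneg[of "max 0 t"] by (simp add: H_max)
  have gain_cont: "continuous_on {0..} gain"
    using gain_deriv by (rule has_real_derivative_half_line_imp_continuous_on)
  have [measurable]: "H_fun f f'' \<beta> \<in> borel_measurable borel"
    unfolding H_max[abs_def]
    by (intro borel_measurable_continuous_onI continuous_intros continuous_on_compose_max_0 f_cont gain_cont)
  define A where "A = C * measure (lebesgue_on \<Omega>) (space (lebesgue_on \<Omega>)) / c"
  have "integrable (lebesgue_on \<Omega>) (\<lambda>x. H_fun f f'' \<beta> (u x)) \<and>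
      (LINT x|lebesgue_on \<Omega>. \<bar>H_fun f f'' \<beta> (u x)\<bar>) \<le> A"
    if u: "dirichlet_solution \<Omega> a f u" "AE x in lebesgue_on \<Omega>. u x > 0" "semistable \<Omega> a f' u" for u
  proof -
    obtain Du where "semistable_equation \<Omega> a u Du (\<lambda>x. f (max 0 (u x))) (\<lambda>x. f' (max 0 (u x))) (f 0)"
      by (rule semistable_equation_of_solution[OF increasing_convex_axioms \<Omega> assms(3) u])
    then interpret semistable_equation \<Omega> a u Du "\<lambda>x. f (max 0 (u x))" "\<lambda>x. f' (max 0 (u x))" "f 0" .
    note [measurable] = L2_measurable[OF H10_L2(1)[OF u_H10]]
    let ?g = "\<lambda>k t. if 0 \<le> t then g k t else g k 0 + g' k 0 * t"
    let ?G = "\<lambda>k t. if 0 \<le> t then G k t else G k 0 + (g' k 0)\<^sup>2 * t"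
    define q where "q k x = f' (max 0 (u x)) * (?g k (u x))\<^sup>2 - f (max 0 (u x)) * ?G k (u x)" for k x
    have q: "integrable (lebesgue_on \<Omega>) (q k)" "(LINT x|lebesgue_on \<Omega>. q k x) \<le> 0" for k
    proof -
      obtain M where M: "\<And>t. 0 \<le> t \<Longrightarrow> \<bar>g' k t\<bar> \<le> M"
        using g'(2)[of k] by (auto simp: bounded_iff)
      note st = stability_test[of "?g k" "\<lambda>t. g' k (max 0 t)" "?G k" M,
          OF has_real_derivative_linear_extension[of "g k" "g' k", OF g] _
            has_real_derivative_linear_extension[of "G k" "\<lambda>t. (g' k t)\<^sup>2", OF G] _
            continuous_on_compose_max_0[OF g'(1)] M]
      show "integrable (lebesgue_on \<Omega>) (q k)" "(LINT x|lebesgue_on \<Omega>. q k x) \<le> 0"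
        unfolding q_def by (rule st; simp add: zero)+
    qed
    \<comment> \<open>The sequence starts at the index \<open>K\<close>, from which on the uniform bounds hold.\<close>
    have below: "AE x in lebesgue_on \<Omega>. - C \<le> q (K + k) x" for k
      using u(2) by eventually_elim (use lower[of "K + k"] in \<open>simp add: q_def\<close>)
    have above: "AE x in lebesgue_on \<Omega>. \<forall>\<^sub>F k in sequentially.
        c * H_fun f f'' \<beta> (u x) - C \<le> q (K + k) x"
      using u(2)
    proof eventually_elim
      case (elim x)
      have "\<forall>\<^sub>F k in sequentially. nat \<lceil>u x\<rceil> \<le> k" by (rule eventually_ge_at_top)
      then show ?case
      proof eventually_elim
        case k: (elim k)
        then have "u x \<le> real (K + k)" by linarith
        then show ?case using minorant[of "K + k" "u x"] elim by (simp add: q_def)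
      qed
    qed
    have "(\<lambda>x. c * H_fun f f'' \<beta> (u x)) \<in> borel_measurable (lebesgue_on \<Omega>)" by measurable
    note bound = integral_bound_of_eventual_minorant[OF fin this _ q(1) q(2) below above]
    have "integrable (lebesgue_on \<Omega>) (\<lambda>x. c * H_fun f f'' \<beta> (u x))"
      "(LINT x|lebesgue_on \<Omega>. c * H_fun f f'' \<beta> (u x))
        \<le> C * measure (lebesgue_on \<Omega>) (space (lebesgue_on \<Omega>))"
      using c H_nonneg by (intro bound; simp)+
    then show ?thesis
      using c H_nonneg by (simp add: A_def field_simps)
  qed
  then show ?thesis by blast
qed

end
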